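(* Let $G$ be a finite, simple, connected graph containing exactly one cycle, and suppose this cycle has odd length. Then $\dim(G)\le Z(G)$.
   Context: $\dim(G)$ is the metric dimension: the minimum size of a set $S\subseteq V(G)$ such that for every two distinct vertices $u,v$ there is $s\in S$ with $d(s,u)\neq d(s,v)$ ($d$ the shortest-path distance). $Z(G)$ is the zero forcing number: the minimum size of a set of initially black vertices such that repeatedly applying the rule "if a black vertex has exactly one white neighbor, that neighbor becomes black" eventually makes all vertices black. *)

theory Defs
  imports "Graph_Theory.Graph_Theory"
begin

definition graph_dist :: "'a pair_pre_digraph \<Rightarrow> 'a \<Rightarrow> 'a \<Rightarrow> ereal" where
  "graph_dist G u v = wf_digraph.\<mu> (with_proj G) (\<lambda>_. 1) u v"

definition resolving_set :: "'a pair_pre_digraph \<Rightarrow> 'a set \<Rightarrow> bool" where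
  "resolving_set G S \<longleftrightarrow> S \<subseteq> pverts G \<and>
     (\<forall>u \<in> pverts G. \<forall>v \<in> pverts G. u \<noteq> v \<longrightarrow> (\<exists>s \<in> S. graph_dist G s u \<noteq> graph_dist G s v))"

definition metric_dimension :: "'a pair_pre_digraph \<Rightarrow> nat" where
  "metric_dimension G = (LEAST k. \<exists>S. resolving_set G S \<and> card S = k)"

definition neighbors :: "'a pair_pre_digraph \<Rightarrow> 'a \<Rightarrow> 'a set" where
  "neighbors G u = {v. (u, v) \<in> parcs G}"

text \<open>The argument sets are the black vertices before and after one vertex \<open>v\<close> is forced.\<close>

definition forcing_step :: "'a pair_pre_digraph \<Rightarrow> 'a set \<Rightarrow> 'a set \<Rightarrow> bool" where
  "forcing_step G B B' \<longleftrightarrow> (\<exists>u \<in> B. \<exists>v. neighbors G u - B = {v} \<and> B' = insert v B)"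

definition zero_forcing_set :: "'a pair_pre_digraph \<Rightarrow> 'a set \<Rightarrow> bool" where
  "zero_forcing_set G S \<longleftrightarrow> S \<subseteq> pverts G \<and> (forcing_step G)\<^sup>*\<^sup>* S (pverts G)"

definition zero_forcing_number :: "'a pair_pre_digraph \<Rightarrow> nat" where
  "zero_forcing_number G = (LEAST k. \<exists>S. zero_forcing_set G S \<and> card S = k)"

text \<open>
  The cycles of \<open>G\<close> as an undirected graph, each represented by its set of undirected edges, so
  that the rotations and the reversal of a closed walk give the same cycle and the length of a
  cycle is the cardinality of this set. The bound on the length of \<open>p\<close> excludes the walks
  \<open>u, v, u\<close>, which the library counts as cycles of a symmetric digraph.
\<close>

definition undirected_cycles :: "'a pair_pre_digraph \<Rightarrow> 'a set set set" where
  "undirected_cycles G =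
     {(\<lambda>(u, v). {u, v}) ` set p | p. pre_digraph.cycle (with_proj G) p \<and> 3 \<le> length p}"

end

theory Submission
  imports Defs
begin

text \<open>
  Call a vertex set a candidate if, among the branches hanging off any vertex, at most one avoids
  it, and if it meets the trees attached to at least two vertices of the cycle. Every zero forcing
  set \<open>S\<close> is a candidate: the root of a branch avoiding \<open>S\<close> must be forced by the vertex the branch
  hangs off, and a vertex forces at most once.

  Let the cycle \<open>c\<close> have length \<open>2m + 1\<close>. If a candidate does not resolve \<open>u\<close> and \<open>w\<close>, then, after a
  rotation and possibly a reflection of \<open>c\<close>, it meets only the trees at \<open>c 0, c (-1), \<dots>, c (1 - m)\<close>,
  and some branch at \<open>c 0\<close> avoids it. In particular a candidate which meets the trees at two
  antipodal vertices of the cycle is resolving.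

  Suppose a zero forcing set \<open>S\<close> is not resolving. As \<open>c 0\<close> has to force the avoided branch, it does
  not force \<open>c 1\<close>; hence \<open>c (i + 1)\<close> forces \<open>c i\<close> for \<open>1 \<le> i \<le> m\<close>, and all these vertices lie on one
  forcing chain, starting at some \<open>r \<in> S\<close>. Choose \<open>s \<in> S\<close> other than \<open>r\<close>, say in the tree at \<open>c (-k)\<close>,
  and replace \<open>r\<close> by \<open>c (m - k)\<close>. The result is again a candidate, it has no more elements than \<open>S\<close>,
  and it now meets two antipodal trees.
\<close>

section \<open>Distances\<close>

text \<open>Distances are axiomatised without walks. \<open>d_next\<close> supplies the first edge
  of a shortest path, so distance proofs become inductions on \<open>d\<close>.\<close>

locale graph_metric =
  fixes V :: "'a set" and E :: "'a \<Rightarrow> 'a \<Rightarrow> bool" and d :: "'a \<Rightarrow> 'a \<Rightarrow> nat"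
  assumes finite_V: "finite V"
    and E_sym: "E x y \<Longrightarrow> E y x"
    and E_V: "E x y \<Longrightarrow> x \<in> V"
    and E_irrefl: "\<not> E x x"
    and d_self: "x \<in> V \<Longrightarrow> d x x = 0"
    and d_sym: "d x y = d y x"
    and d_tri: "x \<in> V \<Longrightarrow> y \<in> V \<Longrightarrow> z \<in> V \<Longrightarrow> d x z \<le> d x y + d y z"
    and d_adj: "E x y \<Longrightarrow> d x y \<le> 1"
    and d_next: "x \<in> V \<Longrightarrow> y \<in> V \<Longrightarrow> x \<noteq> y \<Longrightarrow> \<exists>z. E x z \<and> d x y = Suc (d z y)"
begin

lemma E_V2: "E x y \<Longrightarrow> y \<in> V"
  using E_V E_sym by blast

text \<open>A shortest path from \<open>x\<close> to \<open>y\<close> has to leave \<open>A\<close>,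
  and the edge on which it first does so ends in \<open>v\<close>; the induction follows the path up
  to that edge.\<close>

lemma d_cut_vertex:
  assumes v: "v \<in> V" and cut: "\<And>x y. x \<in> A \<Longrightarrow> y \<notin> A \<Longrightarrow> E x y \<Longrightarrow> y = v"
    and A: "A \<subseteq> V" and x: "x \<in> A" and y: "y \<in> V" "y \<notin> A"
  shows "d x y = d x v + d v y"
proof -
  have "d x v + d v y \<le> d x y" using x
  proof (induction "d x y" arbitrary: x rule: less_induct)
    case less
    have xV: "x \<in> V" using less.prems A by auto
    have "x \<noteq> y" using less.prems y by auto
    then obtain z where z: "E x z" "d x y = Suc (d z y)"
      using d_next xV y by blast
    have zV: "z \<in> V" using z E_V2 by blast
    show ?case
    proof (cases "z \<in> A")
      case True
      with less.hyps z have "d z v + d v y \<le> d z y" by simp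
      moreover have "d x v \<le> d x z + d z v" using d_tri xV zV v by blast
      moreover have "d x z \<le> 1" using d_adj z by blast
      ultimately show ?thesis using z by linarith
    next
      case False
      then have "z = v" using cut less.prems z by blast
      then show ?thesis using z d_adj[OF z(1)] by simp
    qed
  qed
  moreover have "d x y \<le> d x v + d v y" using d_tri x A y v by blast
  ultimately show ?thesis by simp
qed

text \<open>This is how distances are bounded from below: the change of \<open>F\<close> is summed
  along a shortest path. It serves for the height \<open>h\<close> and for the distance to a cycle
  vertex.\<close>

lemma d_lipschitz:
  fixes F :: "'a \<Rightarrow> int"
  assumes F: "\<And>x y. E x y \<Longrightarrow> F x \<le> F y + 1" and "x \<in> V" "y \<in> V"
  shows "F x \<le> F y + int (d x y)"
  using assms(2)
proof (induction "d x y" arbitrary: x rule: less_induct)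
  case less
  show ?case
  proof (cases "x = y")
    case False
    then obtain z where z: "E x z" "d x y = Suc (d z y)"
      using d_next less.prems assms(3) by blast
    then have "F z \<le> F y + int (d z y)" using less.hyps E_V2 by auto
    then show ?thesis using F[OF z(1)] z(2) by simp
  qed simp
qed

end

section \<open>Arithmetic of positions on an odd cycle\<close>

text \<open>The distance on a cycle of length \<open>n\<close> between two positions with difference
  \<open>i\<close>: the shorter way round.\<close>

definition cyclic_norm :: "int \<Rightarrow> int \<Rightarrow> int" where
  "cyclic_norm n i = min (i mod n) (n - i mod n)"

lemma cyclic_norm_cong: "n dvd i - j \<Longrightarrow> cyclic_norm n i = cyclic_norm n j"
  unfolding cyclic_norm_def using mod_eq_dvd_iff[of i n j] by simp

lemma cyclic_norm_small:
  assumes "\<bar>i\<bar> \<le> m" "n = 2 * m + 1" shows "cyclic_norm n i = \<bar>i\<bar>"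
proof (cases "0 \<le> i")
  case True
  then have "i mod n = i" using assms by (intro mod_pos_pos_trivial) auto
  then show ?thesis using assms True by (simp add: cyclic_norm_def)
next
  case False
  have "i mod n = (i + n) mod n" by simp
  also have "\<dots> = i + n" using assms False by (intro mod_pos_pos_trivial) auto
  finally show ?thesis using assms False by (simp add: cyclic_norm_def)
qed

lemma cyclic_representative:
  fixes i m :: int
  assumes "1 \<le> m"
  obtains k where "- m \<le> k" "k \<le> m" "(2 * m + 1) dvd i - k"
proof
  let ?n = "2 * m + 1"
  let ?k = "(i + m) mod ?n - m"
  have "0 \<le> (i + m) mod ?n" "(i + m) mod ?n < ?n"
    using assms pos_mod_bound[of ?n "i + m"] by simp_all
  then show "- m \<le> ?k" "?k \<le> m" by linarith+
  have "i - ?k = (i + m) - (i + m) mod ?n" by simp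
  then show "?n dvd i - ?k" by (metis dvd_minus_mod)
qed

lemma cyclic_norm_succ:
  assumes "1 \<le> m" "n = 2 * m + 1"
  shows "\<bar>cyclic_norm n (i + 1) - cyclic_norm n i\<bar> \<le> 1"
proof -
  obtain k where k: "- m \<le> k" "k \<le> m" "n dvd i - k"
    using cyclic_representative assms by metis
  have "cyclic_norm n i = \<bar>k\<bar>"
    using k cyclic_norm_cong[OF k(3)] cyclic_norm_small[of k m n] assms by simp
  moreover have "\<bar>cyclic_norm n (i + 1) - \<bar>k\<bar>\<bar> \<le> 1"
  proof (cases "k = m")
    case True
    \<comment> \<open>The position after \<open>m\<close> is \<open>- m\<close>: the two antipodes
      of 0 are adjacent and have the same norm.\<close>
    have "n dvd (i + 1) - (- m)"
      using k(3) True assms(2) dvd_add[OF k(3) dvd_refl[of n]] by (simp add: algebra_simps)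
    from cyclic_norm_cong[OF this] show ?thesis
      using True cyclic_norm_small[of "- m" m n] assms by simp
  next
    case False
    have "n dvd (i + 1) - (k + 1)" using k(3) by simp
    from cyclic_norm_cong[OF this] show ?thesis
      using False k cyclic_norm_small[of "k + 1" m n] assms by simp
  qed
  ultimately show ?thesis by simp
qed

lemma cyclic_norm_far:
  assumes "n = 2 * m + 1" "m < \<bar>i\<bar>" "\<bar>i\<bar> \<le> 2 * m" shows "cyclic_norm n i = n - \<bar>i\<bar>"
proof (cases "0 \<le> i")
  case True
  have "n dvd i - (i - n)" by simp
  from cyclic_norm_cong[OF this] show ?thesis
    using assms True cyclic_norm_small[of "i - n" m n] by simp
next
  case False
  have "n dvd i - (i + n)" by simp
  from cyclic_norm_cong[OF this] show ?thesis
    using assms False cyclic_norm_small[of "i + n" m n] by simp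
qed

text \<open>The difference of the distances to two points of the cycle determines the position, except
  on the two arcs where it is extremal. On a cycle of even length this fails: there the difference
  also takes equal values on both sides of the two points.\<close>

lemma cyclic_positions_extremal:
  fixes m \<delta> e p q :: int
  assumes "n = 2 * m + 1" "1 \<le> \<delta>" "\<delta> \<le> m"
    and p: "\<bar>p\<bar> \<le> m" "p \<noteq> 0 \<and> p \<noteq> \<delta> \<longrightarrow> cyclic_norm n p - cyclic_norm n (p - \<delta>) = e"
       "p = 0 \<longrightarrow> e \<le> - \<delta>" "p = \<delta> \<longrightarrow> \<delta> \<le> e"
    and q: "\<bar>q\<bar> \<le> m" "q \<noteq> 0 \<and> q \<noteq> \<delta> \<longrightarrow> cyclic_norm n q - cyclic_norm n (q - \<delta>) = e"
       "q = 0 \<longrightarrow> e \<le> - \<delta>" "q = \<delta> \<longrightarrow> \<delta> \<le> e"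
    and "p \<noteq> q"
  shows "e = - \<delta> \<and> - (m - \<delta>) \<le> p \<and> p \<le> 0 \<or> e = \<delta> \<and> \<delta> \<le> p \<and> p \<le> m"
proof -
  have N: "cyclic_norm n x = \<bar>x\<bar>" if "\<bar>x\<bar> \<le> m" for x
    using that assms cyclic_norm_small by blast
  have D: "cyclic_norm n (x - \<delta>) = (if - m \<le> x - \<delta> then \<bar>x - \<delta>\<bar> else n + x - \<delta>)"
    if "\<bar>x\<bar> \<le> m" for x
    using that assms cyclic_norm_small[of "x - \<delta>" m n] cyclic_norm_far[of n m "x - \<delta>"] by auto
  \<comment> \<open>Solving for \<open>e\<close> on each arc: it varies between the two points and
    on the far arc, and is constantly \<open>- \<delta>\<close> or \<open>\<delta>\<close> behind
    either point. At the points themselves only inequalities are known, since there the landmark may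
    share a tree with a vertex to be resolved.\<close>
  have cls: "0 < x \<and> x < \<delta> \<and> e = 2 * x - \<delta> \<or> - (m - \<delta>) \<le> x \<and> x < 0 \<and> e = - \<delta>
      \<or> x < - (m - \<delta>) \<and> e = \<delta> - 2 * x - 2 * m - 1 \<or> \<delta> < x \<and> e = \<delta>
      \<or> x = 0 \<and> e \<le> - \<delta> \<or> x = \<delta> \<and> \<delta> \<le> e"
    if "\<bar>x\<bar> \<le> m" "x \<noteq> 0 \<and> x \<noteq> \<delta> \<longrightarrow> cyclic_norm n x - cyclic_norm n (x - \<delta>) = e"
       "x = 0 \<longrightarrow> e \<le> - \<delta>" "x = \<delta> \<longrightarrow> \<delta> \<le> e" for x
    using that assms(1-3) N[OF that(1)] D[OF that(1)]
    by (cases "x = 0"; cases "x = \<delta>"; cases "0 < x"; cases "x < \<delta>"; cases "- m \<le> x - \<delta>") auto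
  \<comment> \<open>The oddness of the cycle enters here: the values of \<open>e\<close> on the two
    varying arcs have different parity, so no value occurs on both.\<close>
  have parity: "2 * x - \<delta> \<noteq> \<delta> - 2 * y - 2 * m - 1" for x y
    by presburger
  show ?thesis
    using cls[OF p] cls[OF q] p(1) q(1) assms(2,3) \<open>p \<noteq> q\<close> parity[of p q] parity[of q p]
    by (smt (verit))
qed

section \<open>Trees attached to a cycle\<close>

text \<open>The forest is encoded by parents and heights. Vertices of height 0 form the base, later
  the cycle, whose inner edges are left open; every other edge joins a vertex to its parent.\<close>

locale hanging_forest = graph_metric V E d
  for V :: "'a set" and E and d :: "'a \<Rightarrow> 'a \<Rightarrow> nat" +
  fixes par :: "'a \<Rightarrow> 'a" and h :: "'a \<Rightarrow> nat"
  assumes E_par: "x \<in> V \<Longrightarrow> 0 < h x \<Longrightarrow> E x (par x)"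
    and h_par: "x \<in> V \<Longrightarrow> 0 < h x \<Longrightarrow> h x = Suc (h (par x))"
    and E_cases_par: "E x y \<Longrightarrow>
      h x = 0 \<and> h y = 0 \<or> 0 < h x \<and> y = par x \<or> 0 < h y \<and> x = par y"
begin

definition rt :: "'a \<Rightarrow> 'a" where
  "rt x = (par ^^ h x) x"

text \<open>The descendants of \<open>w\<close>, including \<open>w\<close>. Counting the ascent by
  the difference of heights keeps \<open>par\<close> from being applied at height 0, where nothing
  is known about it.\<close>

definition sub :: "'a \<Rightarrow> 'a set" where
  "sub w = {x \<in> V. h w \<le> h x \<and> (par ^^ (h x - h w)) x = w}"

text \<open>The children of a vertex stand for the branches hanging off it; requiring positive
  height keeps its neighbours on the cycle out of the count.\<close>

definition branch_condition :: "'a set \<Rightarrow> bool" where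
  "branch_condition R \<longleftrightarrow> (\<forall>a\<in>V. \<forall>b\<in>V. 0 < h a \<and> 0 < h b \<and> a \<noteq> b \<and> par a = par b \<longrightarrow>
     sub a \<inter> R \<noteq> {} \<or> sub b \<inter> R \<noteq> {})"

lemma par_V: "x \<in> V \<Longrightarrow> 0 < h x \<Longrightarrow> par x \<in> V"
  using E_par E_V2 by blast

lemma rt_base: "h x = 0 \<Longrightarrow> rt x = x"
  by (simp add: rt_def)

lemma rt_par: "x \<in> V \<Longrightarrow> 0 < h x \<Longrightarrow> rt (par x) = rt x"
  using h_par[of x] by (simp add: rt_def funpow_swap1)

lemma tree_induct [consumes 1, case_names base par]:
  assumes "x \<in> V" "\<And>x. x \<in> V \<Longrightarrow> h x = 0 \<Longrightarrow> P x"
    "\<And>x. x \<in> V \<Longrightarrow> 0 < h x \<Longrightarrow> P (par x) \<Longrightarrow> P x"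
  shows "P x"
  using assms(1)
proof (induction "h x" arbitrary: x)
  case 0
  then show ?case using assms(2) by simp
next
  case (Suc k)
  then have "P (par x)" using par_V h_par[of x] by simp
  then show ?case using assms(3) Suc by simp
qed

lemma rt_V: "x \<in> V \<Longrightarrow> rt x \<in> V \<and> h (rt x) = 0"
  by (induction x rule: tree_induct) (simp_all add: rt_base rt_par)

lemma d_rt_le: "x \<in> V \<Longrightarrow> d x (rt x) \<le> h x"
proof (induction x rule: tree_induct)
  case (base x)
  then show ?case by (simp add: rt_base d_self)
next
  case (par x)
  have "d x (rt x) \<le> d x (par x) + d (par x) (rt x)"
    using par rt_V par_V d_tri by blast
  also have "\<dots> \<le> 1 + h (par x)"
    using d_adj[OF E_par] par rt_par by (metis add_mono)
  finally show ?case using h_par[of x] par by simp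
qed

lemma sub_subset_V: "sub w \<subseteq> V"
  by (auto simp: sub_def)

lemma sub_refl: "w \<in> V \<Longrightarrow> w \<in> sub w"
  by (simp add: sub_def)

lemma sub_h: "x \<in> sub w \<Longrightarrow> h w \<le> h x"
  by (simp add: sub_def)

lemma sub_parI:
  assumes "x \<in> V" "0 < h x" "par x \<in> sub w"
  shows "x \<in> sub w"
proof -
  have "h x - h w = Suc (h (par x) - h w)"
    using h_par[of x] assms by (simp add: sub_def Suc_diff_le)
  then show ?thesis using assms h_par[of x] by (simp add: sub_def funpow_swap1)
qed

lemma sub_parD:
  assumes "x \<in> sub w" "x \<noteq> w"
  shows "x \<in> V" "0 < h x" "par x \<in> sub w"
proof -
  have x: "x \<in> V" "h w \<le> h x" "(par ^^ (h x - h w)) x = w" using assms by (auto simp: sub_def)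
  then have lt: "h w < h x" using assms(2) by (cases "h x = h w") auto
  then have "h x - h w = Suc (h (par x) - h w)" "h w \<le> h (par x)"
    using h_par[of x] x by auto
  then show "x \<in> V" "0 < h x" "par x \<in> sub w"
    using x lt par_V by (auto simp: sub_def funpow_swap1)
qed

lemma sub_induct [consumes 1, case_names base par]:
  assumes "x \<in> sub w" "P w"
    "\<And>x. x \<in> sub w \<Longrightarrow> x \<in> V \<Longrightarrow> 0 < h x \<Longrightarrow> par x \<in> sub w \<Longrightarrow> P (par x) \<Longrightarrow> P x"
  shows "P x"
  using assms(1)
proof (induction "h x" arbitrary: x rule: less_induct)
  case less
  show ?case
  proof (cases "x = w")
    case False
    note D = sub_parD[OF less.prems False]
    then have "P (par x)" using less.hyps[of "par x"] h_par[of x] by simp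
    then show ?thesis using assms(3) D less.prems by blast
  qed (use assms in simp)
qed

lemma sub_rt: "x \<in> sub w \<Longrightarrow> rt x = rt w"
  by (induction x rule: sub_induct) (simp_all add: rt_par)

lemma d_sub_le: "w \<in> V \<Longrightarrow> x \<in> sub w \<Longrightarrow> d x w + h w \<le> h x"
proof (rotate_tac 1, induction x rule: sub_induct)
  case base
  then show ?case by (simp add: d_self)
next
  case (par x)
  have "d x w \<le> d x (par x) + d (par x) w"
    using par par_V d_tri by blast
  then show ?case using par d_adj[OF E_par, of x] h_par[of x] by simp
qed

text \<open>A child of \<open>x\<close> stays in \<open>sub w\<close>, so an edge leaving the branch
  goes to \<open>par x\<close>, and this is outside only for \<open>x = w\<close>.\<close>

lemma sub_exit:
  assumes w: "w \<in> V" "0 < h w" and "x \<in> sub w" "y \<notin> sub w" "E x y"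
  shows "x = w" "y = par w"
proof -
  have x: "x \<in> V" "0 < h x" using assms sub_h[of x w] sub_subset_V by auto
  have y: "y \<in> V" using assms E_V2 by blast
  have "y = par x"
    using E_cases_par[OF \<open>E x y\<close>] x y sub_parI[of y w] assms by auto
  then show "x = w" "y = par w" using sub_parD assms by blast+
qed

lemma sub_disjoint:
  assumes "h a = h b" "a \<noteq> b" shows "sub a \<inter> sub b = {}"
  using assms by (auto simp: sub_def)

text \<open>Every path out of the branch runs through \<open>w\<close> and then
  \<open>par w\<close>, so \<open>d_cut_vertex\<close> applies once at each end of this
  edge.\<close>

lemma d_sub_exit:
  assumes w: "w \<in> V" "0 < h w" and s: "s \<in> sub w" and y: "y \<in> V" "y \<notin> sub w"
  shows "d s y = d s w + 1 + d (par w) y"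
proof -
  have "d y s = d y w + d w s"
    by (rule d_cut_vertex[of w "V - sub w"])
      (use w s y sub_subset_V E_sym E_V2 sub_exit(1) in blast)+
  moreover have "d w y = d w (par w) + d (par w) y"
    by (rule d_cut_vertex[of "par w" "sub w"])
      (use w s y sub_subset_V sub_refl par_V sub_exit(2) in blast)+
  moreover have "d w (par w) = 1"
  proof -
    have "w \<noteq> par w" using E_par w E_irrefl by metis
    then have "d w (par w) \<noteq> 0" using d_next[of w "par w"] w par_V by auto
    then show ?thesis using d_adj[OF E_par[OF w]] by simp
  qed
  ultimately show ?thesis using d_sym by simp
qed

lemma h_lipschitz:
  assumes "x \<in> V" "y \<in> V" shows "h x \<le> h y + d x y"
proof -
  have lip: "int (h x) \<le> int (h y) + 1" if "E x y" for x y
    using E_cases_par[OF that] h_par E_V[OF that] E_V2[OF that] by fastforce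
  have "int (h x) \<le> int (h y) + int (d x y)"
    by (rule d_lipschitz[of "\<lambda>x. int (h x)"])
      (use assms lip in auto)
  then show ?thesis by linarith
qed

text \<open>Climb from both vertices in step until the parents coincide, at the latest at the common
  root.\<close>

lemma siblings_above:
  assumes "u \<in> V" "w \<in> V" "u \<noteq> w" "rt u = rt w" "h u = h w"
  shows "\<exists>a\<in>V. \<exists>b\<in>V. 0 < h a \<and> 0 < h b \<and> a \<noteq> b \<and> par a = par b \<and> u \<in> sub a \<and> w \<in> sub b"
  using assms
proof (induction "h u" arbitrary: u w)
  case 0
  then show ?case by (simp add: rt_base)
next
  case (Suc k)
  then have pos: "0 < h u" "0 < h w" by auto
  show ?case
  proof (cases "par u = par w")
    case True
    then show ?thesis using Suc.prems pos sub_refl by metis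
  next
    case False
    have "\<exists>a\<in>V. \<exists>b\<in>V. 0 < h a \<and> 0 < h b \<and> a \<noteq> b \<and> par a = par b \<and> par u \<in> sub a \<and> par w \<in> sub b"
      using Suc.hyps(1)[of "par u" "par w"] Suc.hyps(2) Suc.prems False pos
        h_par[of u] h_par[of w] par_V rt_par by simp
    then show ?thesis using sub_parI Suc.prems pos by meson
  qed
qed

text \<open>A walk from \<open>s\<close> to \<open>w\<close> has to pass \<open>a\<close> and
  \<open>par a\<close> before it climbs again. As \<open>u\<close> and \<open>w\<close> have equal
  height, this costs at least two edges more than the route to \<open>u\<close> through
  \<open>a\<close>.\<close>

lemma siblings_resolve:
  assumes "a \<in> V" "b \<in> V" "0 < h a" "0 < h b" "a \<noteq> b" "par a = par b"
    and u: "u \<in> sub a" and w: "w \<in> sub b" and "h u = h w" and s: "s \<in> sub a"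
  shows "d s u < d s w"
proof -
  have ab: "h a = h b" using h_par[of a] h_par[of b] assms by simp
  then have wa: "w \<in> V" "w \<notin> sub a" using sub_disjoint assms sub_subset_V by blast+
  have "d s w = d s a + 1 + d (par a) w"
    using d_sub_exit[OF _ _ s wa] assms by simp
  moreover have "h w \<le> h (par a) + d w (par a)"
    using h_lipschitz wa par_V assms by blast
  moreover have "d s u \<le> d s a + d a u"
    using d_tri assms sub_subset_V by blast
  moreover have "d u a + h a \<le> h u" using d_sub_le assms by blast
  moreover have "h a = Suc (h (par a))" using h_par assms by blast
  ultimately show ?thesis using assms(9) d_sym[of u a] d_sym[of w "par a"] by linarith
qed

lemma equal_depth_resolved:
  assumes "branch_condition R" "u \<in> V" "w \<in> V" "u \<noteq> w" "rt u = rt w" "h u = h w"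
  shows "\<exists>s\<in>R. d s u \<noteq> d s w"
proof -
  obtain a b where ab: "a \<in> V" "b \<in> V" "0 < h a" "0 < h b" "a \<noteq> b" "par a = par b"
    "u \<in> sub a" "w \<in> sub b"
    using siblings_above assms by blast
  then consider s where "s \<in> R" "s \<in> sub a" | s where "s \<in> R" "s \<in> sub b"
    using assms(1) unfolding branch_condition_def by blast
  then show ?thesis
  proof cases
    case 1
    then show ?thesis using siblings_resolve[of a b u w s] ab assms(6) by (metis nless_le)
  next
    case 2
    then show ?thesis using siblings_resolve[of b a w u s] ab assms(6) by (metis nless_le)
  qed
qed

lemma top_branch:
  assumes "u \<in> V" "0 < h u"
  shows "\<exists>a\<in>V. h a = 1 \<and> par a = rt u \<and> u \<in> sub a"
  using assms
proof (induction u rule: tree_induct)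
  case (par x)
  show ?case
  proof (cases "h (par x) = 0")
    case True
    then show ?thesis
      using par h_par[of x] rt_par[of x] rt_base[of "par x"] sub_refl[of x]
      by (intro bexI[of _ x]) auto
  next
    case False
    then show ?thesis using par sub_parI rt_par by (metis gr0I)
  qed
qed simp

lemma tree_exit:
  assumes "E x y" "rt x \<noteq> rt y"
  shows "h x = 0" "h y = 0" "rt x = x" "rt y = y"
proof -
  have "x \<in> V" "y \<in> V" using assms(1) E_V E_V2 by blast+
  then have "h x = 0 \<and> h y = 0"
    using E_cases_par[OF assms(1)] assms(2) rt_par by auto
  then show "h x = 0" "h y = 0" "rt x = x" "rt y = y" by (simp_all add: rt_base)
qed

lemma d_different_trees:
  assumes "s \<in> V" "u \<in> V" "rt s \<noteq> rt u"
  shows "d s u = d s (rt u) + d (rt u) u"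
proof (rule d_cut_vertex[of "rt u" "{x \<in> V. rt x \<noteq> rt u}"])
  show "y = rt u" if "x \<in> {x \<in> V. rt x \<noteq> rt u}" "y \<notin> {x \<in> V. rt x \<noteq> rt u}" "E x y" for x y
    using that tree_exit[of x y] E_V2 by auto
qed (use assms rt_V in auto)

end

section \<open>An odd cycle with attached trees\<close>

text \<open>The cycle is indexed by all integers with period \<open>2 * m + 1\<close>, so that
  rotations and reflections are affine changes of the index. \<open>E_base\<close> excludes
  chords.\<close>

locale odd_unicyclic = hanging_forest V E d par h
  for V :: "'a set" and E and d :: "'a \<Rightarrow> 'a \<Rightarrow> nat" and par h +
  fixes c :: "int \<Rightarrow> 'a" and m :: int
  assumes m_pos: "1 \<le> m"
    and c_eq: "c i = c j \<longleftrightarrow> (2 * m + 1) dvd i - j"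
    and base_iff: "x \<in> V \<and> h x = 0 \<longleftrightarrow> x \<in> range c"
    and E_c: "E (c i) (c (i + 1))"
    and E_base: "E x y \<Longrightarrow> h x = 0 \<Longrightarrow> h y = 0 \<Longrightarrow>
      \<exists>i. x = c i \<and> y = c (i + 1) \<or> x = c (i + 1) \<and> y = c i"
begin

abbreviation N :: "int \<Rightarrow> int" where
  "N \<equiv> cyclic_norm (2 * m + 1)"

lemma c_V: "c i \<in> V" and h_c: "h (c i) = 0"
  using base_iff[of "c i"] by auto

lemma c_neq:
  assumes "0 < \<bar>i - j\<bar>" "\<bar>i - j\<bar> \<le> 2 * m"
  shows "c i \<noteq> c j"
proof
  assume "c i = c j"
  then have "(2 * m + 1) dvd i - j" using c_eq by blast
  then show False using dvd_imp_le_int[of "i - j" "2 * m + 1"] assms by auto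
qed

lemma rt_c: "rt (c i) = c i"
  by (simp add: rt_base h_c)

lemma rt_ex: "x \<in> V \<Longrightarrow> \<exists>i. rt x = c i"
  using rt_V base_iff[of "rt x"] by auto

lemma rt_position:
  assumes "x \<in> V" obtains k where "- m \<le> k" "k \<le> m" "rt x = c k"
proof -
  obtain i where i: "rt x = c i" using rt_ex assms by blast
  obtain k where "- m \<le> k" "k \<le> m" "(2 * m + 1) dvd i - k"
    using cyclic_representative[OF m_pos] by blast
  then show thesis using that i c_eq by metis
qed

lemma E_from_c:
  assumes "E (c i) y"
  shows "y = c (i + 1) \<or> y = c (i - 1) \<or> 0 < h y \<and> par y = c i"
proof (cases "h y = 0")
  case True
  then obtain j where "c i = c j \<and> y = c (j + 1) \<or> c i = c (j + 1) \<and> y = c j"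
    using E_base[OF assms h_c] by blast
  then show ?thesis using c_eq
    by (metis add_diff_cancel_right diff_add_cancel diff_diff_eq2 add_diff_cancel_right')
next
  case False
  then show ?thesis using E_cases_par[OF assms] h_c by auto
qed

lemma E_c_minus: "E (c i) (c (i - 1))"
  using E_sym[OF E_c[of "i - 1"]] by simp

lemma d_c_le_nat: "d (c i) (c (i + int k)) \<le> k"
proof (induction k)
  case 0
  then show ?case using d_self c_V by simp
next
  case (Suc k)
  have "d (c i) (c (i + int (Suc k))) \<le> d (c i) (c (i + int k)) + d (c (i + int k)) (c (i + int (Suc k)))"
    using d_tri c_V by blast
  moreover have "d (c (i + int k)) (c (i + int (Suc k))) \<le> 1"
    using d_adj[OF E_c[of "i + int k"]] by (simp add: algebra_simps)
  ultimately show ?case using Suc by linarith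
qed

lemma d_c_le: "int (d (c i) (c j)) \<le> \<bar>i - j\<bar>"
proof (cases "i \<le> j")
  case True
  then show ?thesis using d_c_le_nat[of i "nat (j - i)"] by simp
next
  case False
  then show ?thesis using d_c_le_nat[of j "nat (i - j)"] d_sym[of "c i" "c j"] by simp
qed

lemma d_c_le_N: "int (d (c i) (c j)) \<le> N (i - j)"
proof -
  obtain k where k: "- m \<le> k" "k \<le> m" "(2 * m + 1) dvd (i - j) - k"
    using cyclic_representative[OF m_pos] by blast
  then have "N (i - j) = \<bar>k\<bar>"
    using cyclic_norm_cong[OF k(3)] cyclic_norm_small[of k m] by simp
  moreover have "c i = c (j + k)" using k(3) c_eq by (simp add: algebra_simps)
  ultimately show ?thesis using d_c_le[of "j + k" j] by simp
qed

lemma N_cong: "c i = c i' \<Longrightarrow> N (i - j) = N (i' - j)"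
  using c_eq[of i i'] cyclic_norm_cong[of "2 * m + 1" "i - j" "i' - j"] by simp

lemma N_0: "N 0 = 0"
  using cyclic_norm_small[of 0 m] m_pos by simp

text \<open>The upper bound walks to the root and then along the shorter arc; the lower bound is a
  potential argument.\<close>

lemma d_to_cycle:
  assumes x: "x \<in> V" and i: "rt x = c i"
  shows "int (d x (c j)) = int (h x) + N (i - j)"
proof (rule antisym)
  have "int (d x (c j)) \<le> int (d x (c i)) + int (d (c i) (c j))"
    using d_tri[of x "c i" "c j"] x c_V by simp
  then show "int (d x (c j)) \<le> int (h x) + N (i - j)"
    using d_rt_le[OF x] d_c_le_N[of i j] i by simp
next
  \<comment> \<open>\<open>idx\<close> picks some position of the root on the cycle; by
    \<open>F_eq\<close> the choice does not matter. The potential \<open>F\<close> is the claimed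
    distance to \<open>c j\<close>.\<close>
  define idx where "idx x = (SOME i. rt x = c i)" for x
  have idx: "rt x = c (idx x)" if "x \<in> V" for x
    unfolding idx_def using someI_ex[OF rt_ex[OF that]] .
  define F where "F x = int (h x) + N (idx x - j)" for x
  have F_eq: "F x = int (h x) + N (i - j)" if "x \<in> V" "rt x = c i" for x i
    using N_cong[of "idx x" i j] idx that by (simp add: F_def)
  have "F x \<le> F (c j) + int (d x (c j))"
  proof (rule d_lipschitz)
    fix x y assume xy: "E x y"
    then have V: "x \<in> V" "y \<in> V" using E_V E_V2 by blast+
    from E_cases_par[OF xy] show "F x \<le> F y + 1"
    proof (elim disjE conjE)
      assume h: "h x = 0" "h y = 0"
      then obtain k where k: "x = c k \<and> y = c (k + 1) \<or> x = c (k + 1) \<and> y = c k"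
        using E_base xy by blast
      have "\<bar>N (k + 1 - j) - N (k - j)\<bar> \<le> 1"
        using cyclic_norm_succ[OF m_pos refl, of "k - j"] by (simp add: algebra_simps)
      then show ?thesis
        using k F_eq[OF c_V rt_c, of k] F_eq[OF c_V rt_c, of "k + 1"] by (auto simp: h_c)
    next
      assume "0 < h x" "y = par x"
      then show ?thesis
        using F_eq[OF V(1) idx[OF V(1)]] F_eq[of y "idx x"] rt_par[of x] idx[OF V(1)] V h_par[of x] by simp
    next
      assume "0 < h y" "x = par y"
      then show ?thesis
        using F_eq[OF V(2) idx[OF V(2)]] F_eq[of x "idx y"] rt_par[of y] idx[OF V(2)] V h_par[of y] by simp
    qed
  qed (use x c_V in auto)
  then show "int (h x) + N (i - j) \<le> int (d x (c j))"
    using F_eq[OF x i] F_eq[OF c_V rt_c, of j] h_c N_0 by simp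
qed

lemma d_between_trees:
  assumes "s \<in> V" "u \<in> V" "rt s \<noteq> rt u" "rt s = c p" "rt u = c q"
  shows "int (d s u) = int (h s) + N (p - q) + int (h u)"
  using d_different_trees[OF assms(1-3)] d_to_cycle[OF assms(1,4), of q]
    d_to_cycle[OF assms(2,5), of q] d_sym[of u "rt u"] assms(5) N_0
  by simp

lemma N_neg: "N (- i) = N i"
proof -
  obtain k where k: "- m \<le> k" "k \<le> m" "(2 * m + 1) dvd i - k"
    using cyclic_representative[OF m_pos] by blast
  have "(2 * m + 1) dvd - i - (- k)" using k(3) by (metis dvd_minus_iff minus_diff_minus)
  from cyclic_norm_cong[OF this] cyclic_norm_cong[OF k(3)] show ?thesis
    using k cyclic_norm_small[of k m] cyclic_norm_small[of "- k" m] by simp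
qed

text \<open>Allows any cycle vertex to be placed at index 0 and either direction to be chosen as
  positive.\<close>

lemma reparametrise:
  assumes "\<sigma> = 1 \<or> \<sigma> = - 1"
  shows "odd_unicyclic V E d par h (\<lambda>i. c (k + \<sigma> * i)) m"
proof
  show "1 \<le> m" by (rule m_pos)
  show "c (k + \<sigma> * i) = c (k + \<sigma> * j) \<longleftrightarrow> (2 * m + 1) dvd i - j" for i j
    using assms c_eq[of "k + \<sigma> * i" "k + \<sigma> * j"] dvd_diff_commute[of "2 * m + 1" i j] by auto
  have "range (\<lambda>i. c (k + \<sigma> * i)) = range c"
  proof -
    have "c i = c (k + \<sigma> * (\<sigma> * (i - k)))" for i using assms by auto
    then show ?thesis by (auto simp: image_iff)
  qed
  then show "x \<in> V \<and> h x = 0 \<longleftrightarrow> x \<in> range (\<lambda>i. c (k + \<sigma> * i))" for x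
    using base_iff by simp
  show "E (c (k + \<sigma> * i)) (c (k + \<sigma> * (i + 1)))" for i
    using assms E_c[of "k + i"] E_c_minus[of "k - i"] by (auto simp: algebra_simps)
  show "\<exists>i. x = c (k + \<sigma> * i) \<and> y = c (k + \<sigma> * (i + 1)) \<or> x = c (k + \<sigma> * (i + 1)) \<and> y = c (k + \<sigma> * i)"
    if xy: "E x y" "h x = 0" "h y = 0" for x y
  proof -
    obtain j where j: "x = c j \<and> y = c (j + 1) \<or> x = c (j + 1) \<and> y = c j"
      using E_base[OF xy] by blast
    from assms show ?thesis
    proof
      assume "\<sigma> = 1"
      then show ?thesis using j by (intro exI[of _ "j - k"]) (auto simp: algebra_simps)
    next
      assume "\<sigma> = - 1"
      then show ?thesis using j by (intro exI[of _ "k - j - 1"]) (auto simp: algebra_simps)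
    qed
  qed
qed

section \<open>Sets that fail to resolve\<close>

text \<open>The normal form of a candidate that fails to resolve: it lies in the trees over
  \<open>m\<close> consecutive cycle vertices, an arc too short to contain an antipodal
  pair.\<close>

definition one_sided :: "'a set \<Rightarrow> bool" where
  "one_sided R \<longleftrightarrow> (\<forall>s\<in>R. \<exists>i. 0 \<le> i \<and> i \<le> m - 1 \<and> rt s = c (- i)) \<and>
     (\<exists>a\<in>V. h a = 1 \<and> par a = c 0 \<and> sub a \<inter> R = {})"

text \<open>By \<open>hu\<close>, both \<open>u\<close> and \<open>w\<close> are equally far from
  \<open>c 0\<close>. A landmark in the branch of \<open>u\<close> at \<open>c 0\<close> would be
  nearer to \<open>u\<close>, because its route to \<open>u\<close> need not descend to
  \<open>c 0\<close>, while its route to \<open>w\<close> must.\<close>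

lemma empty_branch_of_unresolved:
  assumes R: "R \<subseteq> V" "\<forall>s\<in>R. d s u = d s w"
    and u: "u \<in> V" "rt u = c 0" and w: "w \<in> V" "rt w = c \<delta>"
    and \<delta>: "1 \<le> \<delta>" "\<delta> \<le> m" and hu: "int (h u) = \<delta> + int (h w)"
  shows "\<exists>a\<in>V. h a = 1 \<and> par a = c 0 \<and> sub a \<inter> R = {}"
proof -
  have "0 < h u" using \<delta> hu by linarith
  then obtain a where a: "a \<in> V" "h a = 1" "par a = c 0" "u \<in> sub a"
    using top_branch u by metis
  have "sub a \<inter> R = {}"
  proof (rule ccontr)
    assume "sub a \<inter> R \<noteq> {}"
    then obtain s where s: "s \<in> R" "s \<in> sub a" by blast
    have sV: "s \<in> V" using s R by auto
    have rs: "rt s = c 0" using sub_rt[OF s(2)] sub_rt[OF a(4)] u by simp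
    have "rt s \<noteq> rt w"
      using rs w(2) \<delta> c_eq[of 0 \<delta>] zdvd_imp_le[of "2 * m + 1" \<delta>] by auto
    then have "int (d s w) = int (h s) + N (0 - \<delta>) + int (h w)"
      using d_between_trees sV w rs by blast
    then have "int (d s w) = int (h s) + \<delta> + int (h w)"
      using \<delta> cyclic_norm_small[of "0 - \<delta>" m] by simp
    moreover have "d s u \<le> d s a + d a u" using d_tri sV a u by blast
    ultimately show False
      using d_sub_le[OF a(1,4)] d_sub_le[OF a(1) s(2)] d_sym[of a u] a(2) hu R(2) s(1) by fastforce
  qed
  then show ?thesis using a by blast
qed

text \<open>For a landmark outside both trees, equal distances mean that its cycle distances to the
  two roots differ by the difference \<open>e\<close> of heights. Landmarks in two different trees
  force \<open>e\<close> to be extremal, which confines all landmarks to the arc behind one of the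
  roots.\<close>

lemma unresolved_positions:
  assumes R: "R \<subseteq> V" "\<forall>s\<in>R. d s u = d s w"
    and two: "s1 \<in> R" "s2 \<in> R" "rt s1 \<noteq> rt s2"
    and u: "u \<in> V" "rt u = c 0" and w: "w \<in> V" "rt w = c \<delta>"
    and \<delta>: "1 \<le> \<delta>" "\<delta> \<le> m"
  shows "int (h u) = \<delta> + int (h w) \<and> (\<forall>s\<in>R. \<exists>i. 0 \<le> i \<and> i \<le> m - \<delta> \<and> rt s = c (- i)) \<or>
    int (h w) = \<delta> + int (h u) \<and> (\<forall>s\<in>R. \<exists>i. 0 \<le> i \<and> i \<le> m - \<delta> \<and> rt s = c (\<delta> + i))"
proof -
  define e where "e = int (h w) - int (h u)"
  have ne: "c 0 \<noteq> c \<delta>"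
    using \<delta> c_eq[of 0 \<delta>] zdvd_imp_le[of "2 * m + 1" \<delta>] by auto
  have N\<delta>: "N \<delta> = \<delta>" "N (- \<delta>) = \<delta>"
    using \<delta> cyclic_norm_small[of \<delta> m] N_neg[of \<delta>] by auto
  \<comment> \<open>If the landmark shares a tree with \<open>u\<close> or \<open>w\<close>, the
    distance inside that tree is bounded only by the route through the root, which leaves an
    inequality.\<close>
  have local: "(p \<noteq> 0 \<and> p \<noteq> \<delta> \<longrightarrow> N p - N (p - \<delta>) = e) \<and> (p = 0 \<longrightarrow> e \<le> - \<delta>) \<and> (p = \<delta> \<longrightarrow> \<delta> \<le> e)"
    if s: "s \<in> R" "rt s = c p" and p: "\<bar>p\<bar> \<le> m" for s p
  proof -
    have sV: "s \<in> V" and eq: "d s u = d s w" using s R by auto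
    have inj: "c p = c q \<longrightarrow> p = q" if "\<bar>q\<bar> \<le> m" for q
    proof
      assume "c p = c q"
      then have "(2 * m + 1) dvd p - q" using c_eq by blast
      then show "p = q" using p that dvd_imp_le_int[of "p - q" "2 * m + 1"] by (cases "p = q") auto
    qed
    have "N p - N (p - \<delta>) = e" if "p \<noteq> 0" "p \<noteq> \<delta>"
      using d_between_trees[OF sV u(1) _ s(2) u(2)] d_between_trees[OF sV w(1) _ s(2) w(2)]
        inj[of 0] inj[of \<delta>] that \<delta> eq s u w unfolding e_def by auto
    moreover have "e \<le> - \<delta>" if "p = 0"
    proof -
      have "int (d s w) = int (h s) + \<delta> + int (h w)"
        using d_between_trees[OF sV w(1) _ s(2) w(2)] that ne s w N\<delta> by simp
      moreover have "d s u \<le> d s (c 0) + d (c 0) u" using d_tri sV u c_V by blast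
      moreover have "d s (c 0) \<le> h s" "d (c 0) u \<le> h u"
        using d_rt_le[OF sV] d_rt_le[OF u(1)] d_sym s(2) u(2) that by metis+
      ultimately show ?thesis using eq unfolding e_def by linarith
    qed
    moreover have "\<delta> \<le> e" if "p = \<delta>"
    proof -
      have "int (d s u) = int (h s) + \<delta> + int (h u)"
        using d_between_trees[OF sV u(1) _ s(2) u(2)] that ne s u N\<delta> by simp
      moreover have "d s w \<le> d s (c \<delta>) + d (c \<delta>) w" using d_tri sV w c_V by blast
      moreover have "d s (c \<delta>) \<le> h s" "d (c \<delta>) w \<le> h w"
        using d_rt_le[OF sV] d_rt_le[OF w(1)] d_sym s(2) w(2) that by metis+
      ultimately show ?thesis using eq unfolding e_def by linarith
    qed
    ultimately show ?thesis by blast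
  qed
  have pos: "\<exists>p. rt s = c p \<and> (e = - \<delta> \<and> - (m - \<delta>) \<le> p \<and> p \<le> 0 \<or> e = \<delta> \<and> \<delta> \<le> p \<and> p \<le> m)"
    if s: "s \<in> R" for s
  proof -
    \<comment> \<open>A landmark in another tree provides the second position that
      \<open>cyclic_positions_extremal\<close> needs.\<close>
    obtain s' where s': "s' \<in> R" "rt s \<noteq> rt s'" using two by metis
    obtain p where p: "- m \<le> p" "p \<le> m" "rt s = c p" using rt_position s R by blast
    obtain q where q: "- m \<le> q" "q \<le> m" "rt s' = c q" using rt_position s' R by blast
    have "p \<noteq> q" using p q s' by auto
    moreover have "\<bar>p\<bar> \<le> m" "\<bar>q\<bar> \<le> m" using p q by auto
    ultimately show ?thesis
      using cyclic_positions_extremal[OF refl \<delta>, of p e q] local[OF s p(3)] local[OF s'(1) q(3)] p(3)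
      by blast
  qed
  show ?thesis
  proof (cases "e = \<delta>")
    case True
    have "\<exists>i. 0 \<le> i \<and> i \<le> m - \<delta> \<and> rt s = c (\<delta> + i)" if s: "s \<in> R" for s
    proof -
      obtain p where "rt s = c p" "\<delta> \<le> p" "p \<le> m" using pos[OF s] True \<delta> by auto
      then show ?thesis by (intro exI[of _ "p - \<delta>"]) auto
    qed
    then show ?thesis using True e_def by auto
  next
    case False
    have "\<exists>i. 0 \<le> i \<and> i \<le> m - \<delta> \<and> rt s = c (- i)" if s: "s \<in> R" for s
    proof -
      obtain p where "rt s = c p" "- (m - \<delta>) \<le> p" "p \<le> 0" using pos[OF s] False \<delta> by auto
      then show ?thesis by (intro exI[of _ "- p"]) auto
    qed
    moreover have "e = - \<delta>" using pos[OF two(1)] False by blast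
    ultimately show ?thesis using e_def by auto
  qed
qed

lemma unresolved_one_sided:
  assumes R: "R \<subseteq> V" "branch_condition R"
    and two: "s1 \<in> R" "s2 \<in> R" "rt s1 \<noteq> rt s2"
    and uw: "u \<in> V" "w \<in> V" "u \<noteq> w" and un: "\<forall>s\<in>R. d s u = d s w"
  shows "\<exists>c'. odd_unicyclic V E d par h c' m \<and> odd_unicyclic.one_sided V par h c' m R"
proof -
  \<comment> \<open>Seen from a landmark in another tree, two vertices of one tree are equally far
    only at equal height, and that case is settled by the branch condition.\<close>
  have "rt u \<noteq> rt w"
  proof
    assume rt: "rt u = rt w"
    obtain s where s: "s \<in> R" "rt s \<noteq> rt u" using two by metis
    then have "d s (rt u) + d (rt u) u = d s (rt u) + d (rt u) w"
      using d_different_trees[of s u] d_different_trees[of s w] rt uw un R by auto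
    moreover have "d (rt x) x = h x" if "x \<in> V" for x
    proof -
      obtain i where "rt x = c i" using rt_ex \<open>x \<in> V\<close> by blast
      then show ?thesis using d_to_cycle[of x i i] that N_0 d_sym[of x "c i"] by simp
    qed
    ultimately have "h u = h w" using uw rt by (metis add_left_cancel)
    then show False using equal_depth_resolved[OF R(2) uw rt] un by blast
  qed
  obtain k where k: "rt u = c k" using rt_ex uw by blast
  obtain l where l: "rt w = c l" using rt_ex uw by blast
  obtain t where t: "- m \<le> t" "t \<le> m" "(2 * m + 1) dvd (l - k) - t"
    using cyclic_representative[OF m_pos] by blast
  have wt: "rt w = c (k + t)" using t(3) l c_eq[of l "k + t"] by (simp add: algebra_simps)
  have "t \<noteq> 0" using wt k \<open>rt u \<noteq> rt w\<close> by auto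
  \<comment> \<open>The sign orients the cycle so that the root of \<open>w\<close> gets a positive
    index \<delta>, at most \<open>m\<close>, when the root of \<open>u\<close> is at 0.\<close>
  define \<sigma> :: int where "\<sigma> = (if 0 < t then 1 else - 1)"
  define \<delta> where "\<delta> = \<bar>t\<bar>"
  have \<sigma>: "\<sigma> = 1 \<or> \<sigma> = - 1" "t = \<sigma> * \<delta>" by (auto simp: \<sigma>_def \<delta>_def)
  have \<delta>: "1 \<le> \<delta>" "\<delta> \<le> m" using t \<open>t \<noteq> 0\<close> by (auto simp: \<delta>_def)
  define c' where "c' i = c (k + \<sigma> * i)" for i
  interpret c': odd_unicyclic V E d par h c' m
    unfolding c'_def by (rule reparametrise[OF \<sigma>(1)])
  have u': "rt u = c' 0" and w': "rt w = c' \<delta>" using k wt \<sigma> by (auto simp: c'_def)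
  from c'.unresolved_positions[OF R(1) un two uw(1) u' uw(2) w' \<delta>]
  show ?thesis
  proof (elim disjE conjE)
    assume a: "int (h u) = \<delta> + int (h w)" "\<forall>s\<in>R. \<exists>i. 0 \<le> i \<and> i \<le> m - \<delta> \<and> rt s = c' (- i)"
    have "\<forall>s\<in>R. \<exists>i. 0 \<le> i \<and> i \<le> m - 1 \<and> rt s = c' (- i)"
      using a(2) \<delta> by (meson diff_left_mono order_trans)
    then have "c'.one_sided R" unfolding c'.one_sided_def
      using c'.empty_branch_of_unresolved[OF R(1) un uw(1) u' uw(2) w' \<delta> a(1)] by blast
    then show ?thesis using c'.odd_unicyclic_axioms by blast
  next
    assume a: "int (h w) = \<delta> + int (h u)" "\<forall>s\<in>R. \<exists>i. 0 \<le> i \<and> i \<le> m - \<delta> \<and> rt s = c' (\<delta> + i)"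
    \<comment> \<open>Here \<open>u\<close> and \<open>w\<close> change roles: the reflection puts
      the root of \<open>w\<close> at index 0 and that of \<open>u\<close> at \<delta>.\<close>
    define c'' where "c'' i = c' (\<delta> + (- 1) * i)" for i
    interpret c'': odd_unicyclic V E d par h c'' m
      unfolding c''_def by (rule c'.reparametrise) simp
    have w'': "rt w = c'' 0" and u'': "rt u = c'' \<delta>" using u' w' by (auto simp: c''_def)
    have "\<forall>s\<in>R. \<exists>i. 0 \<le> i \<and> i \<le> m - 1 \<and> rt s = c'' (- i)"
    proof
      fix s assume "s \<in> R"
      then obtain i where "0 \<le> i" "i \<le> m - \<delta>" "rt s = c' (\<delta> + i)" using a by blast
      then show "\<exists>i. 0 \<le> i \<and> i \<le> m - 1 \<and> rt s = c'' (- i)"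
        using \<delta> by (intro exI[of _ i]) (auto simp: c''_def)
    qed
    moreover have "\<forall>s\<in>R. d s w = d s u" using un by simp
    ultimately have "c''.one_sided R" unfolding c''.one_sided_def
      using c''.empty_branch_of_unresolved[OF R(1) _ uw(2) w'' uw(1) u'' \<delta> a(1)] by blast
    then show ?thesis using c''.odd_unicyclic_axioms by blast
  qed
qed

text \<open>The trees met by a one-sided set have roots at most \<open>m - 1\<close> apart, while
  antipodal roots are \<open>m\<close> apart.\<close>

lemma antipodal_resolving:
  assumes R: "R \<subseteq> V" "branch_condition R"
    and two: "s1 \<in> R" "s2 \<in> R" "rt s1 = c i" "rt s2 = c (i + m)"
    and uw: "u \<in> V" "w \<in> V" "u \<noteq> w"
  shows "\<exists>s\<in>R. d s u \<noteq> d s w"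
proof (rule ccontr)
  assume un: "\<not> (\<exists>s\<in>R. d s u \<noteq> d s w)"
  have dm: "int (d (c i) (c (i + m))) = m"
    using d_to_cycle[OF c_V rt_c, of i "i + m"] m_pos h_c N_neg cyclic_norm_small[of m m] by simp
  then have "rt s1 \<noteq> rt s2" using two m_pos d_self c_V by fastforce
  then obtain c' where c': "odd_unicyclic V E d par h c' m" "odd_unicyclic.one_sided V par h c' m R"
    using unresolved_one_sided[OF R two(1,2) _ uw] un by blast
  interpret c': odd_unicyclic V E d par h c' m by fact
  obtain x y where "0 \<le> x" "x \<le> m - 1" "rt s1 = c' (- x)" "0 \<le> y" "y \<le> m - 1" "rt s2 = c' (- y)"
    using c'(2) two unfolding c'.one_sided_def by blast
  then show False using c'.d_c_le[of "- x" "- y"] dm two by simp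
qed

end

section \<open>Zero forcing\<close>

text \<open>\<open>f v\<close> is the vertex that forces \<open>v\<close>, and \<open>t v\<close> the time at which this happens.\<close>

locale forcing_schedule = odd_unicyclic V E d par h c m
  for V :: "'a set" and E and d :: "'a \<Rightarrow> 'a \<Rightarrow> nat" and par h c m +
  fixes S :: "'a set" and t :: "'a \<Rightarrow> nat" and f :: "'a \<Rightarrow> 'a"
  assumes S_V: "S \<subseteq> V"
    and E_f: "v \<in> V - S \<Longrightarrow> E (f v) v"
    and t_f: "v \<in> V - S \<Longrightarrow> t (f v) < t v"
    and t_other: "v \<in> V - S \<Longrightarrow> E (f v) y \<Longrightarrow> y \<noteq> v \<Longrightarrow> t y < t v"
begin

text \<open>If one vertex forced both, each of them would have to be black before the other.\<close>

lemma f_inj: "v \<in> V - S \<Longrightarrow> w \<in> V - S \<Longrightarrow> f v = f w \<Longrightarrow> v = w"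
  using t_other[of v w] t_other[of w v] E_f[of v] E_f[of w] by (cases "v = w") auto

text \<open>A forcer is black before the vertex it forces, so the forcer of the earliest vertex of
  \<open>A\<close> lies outside \<open>A\<close>.\<close>

lemma first_forced:
  assumes "A \<subseteq> V" "A \<noteq> {}" "A \<inter> S = {}"
  obtains x where "x \<in> A" "f x \<notin> A" "E (f x) x" "\<And>y. y \<in> A \<Longrightarrow> t x \<le> t y"
proof -
  obtain x where x: "x \<in> A" "\<And>y. y \<in> A \<Longrightarrow> t x \<le> t y"
    using ex_has_least_nat[of "\<lambda>x. x \<in> A" _ t] assms(2) by blast
  then have "x \<in> V - S" using assms by blast
  then have "f x \<notin> A" "E (f x) x" using x(2)[of "f x"] E_f t_f[of x] by auto
  then show thesis using that x by blast
qed

text \<open>The first vertex of the branch to turn black is forced from outside, and the only edge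
  into the branch is that from \<open>par a\<close> to \<open>a\<close>.\<close>

lemma forced_by_parent:
  assumes "a \<in> V" "0 < h a" "sub a \<inter> S = {}"
  shows "a \<in> V - S" "f a = par a"
proof -
  have ne: "sub a \<noteq> {}" using sub_refl assms by blast
  obtain x where x: "x \<in> sub a" "f x \<notin> sub a" "E (f x) x"
    using first_forced[OF sub_subset_V ne assms(3)] by blast
  then show "f a = par a" using sub_exit[OF assms(1,2) x(1,2) E_sym[OF x(3)]] by simp
  show "a \<in> V - S" using assms sub_refl by blast
qed

lemma branch_condition_S: "branch_condition S"
  unfolding branch_condition_def
proof (intro ballI impI, rule ccontr)
  fix a b assume ab: "a \<in> V" "b \<in> V" "0 < h a \<and> 0 < h b \<and> a \<noteq> b \<and> par a = par b"
    and "\<not> (sub a \<inter> S \<noteq> {} \<or> sub b \<inter> S \<noteq> {})"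
  then show False using forced_by_parent[of a] forced_by_parent[of b] f_inj[of a b] by auto
qed

text \<open>Otherwise the first vertex outside this tree to turn black is forced by
  \<open>c i\<close>, although at least one of the two cycle neighbours of \<open>c i\<close> is
  another vertex that is still white.\<close>

lemma S_not_in_one_tree: "\<exists>s\<in>S. rt s \<noteq> c i"
proof (rule ccontr)
  assume *: "\<not> ?thesis"
  let ?A = "{x \<in> V. rt x \<noteq> c i}"
  have nb: "c (i + 1) \<in> ?A" "c (i - 1) \<in> ?A" "c (i + 1) \<noteq> c (i - 1)"
    using c_V rt_c c_neq[of "i + 1" i] c_neq[of "i - 1" i] c_neq[of "i + 1" "i - 1"] m_pos by auto
  have "?A \<subseteq> V" "?A \<noteq> {}" "?A \<inter> S = {}" using nb * by blast+
  then obtain x where x: "x \<in> ?A" "f x \<notin> ?A" "E (f x) x" "\<And>y. y \<in> ?A \<Longrightarrow> t x \<le> t y"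
    using first_forced[of ?A] by blast
  have "rt (f x) = c i" using x E_V by blast
  then have fx: "f x = c i" using tree_exit(3)[OF x(3)] x(1) by auto
  have xS: "x \<in> V - S" using x * by blast
  have "t y < t x" if "y = c (i + 1) \<or> y = c (i - 1)" "y \<noteq> x" for y
    using t_other[OF xS, of y] that E_c[of i] E_c_minus[of i] unfolding fx by blast
  then show False using x(4)[OF nb(1)] x(4)[OF nb(2)] nb(3) by (metis leD)
qed

lemma S_two_trees: "\<exists>s1\<in>S. \<exists>s2\<in>S. rt s1 \<noteq> rt s2"
proof -
  obtain s1 where s1: "s1 \<in> S" using S_not_in_one_tree by blast
  then obtain i where "rt s1 = c i" using rt_ex S_V by blast
  then show ?thesis using S_not_in_one_tree[of i] s1 by metis
qed

section \<open>Forcing chains and the exchange\<close>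

definition forces :: "'a \<Rightarrow> 'a \<Rightarrow> bool" where
  "forces x y \<longleftrightarrow> y \<in> V - S \<and> x = f y"

text \<open>Going back from forcer to forcer decreases \<open>t\<close>, so the walk ends in
  \<open>S\<close>.\<close>

lemma chain_start:
  assumes "v \<in> V" shows "\<exists>r\<in>S. forces\<^sup>*\<^sup>* r v"
  using assms
proof (induction "t v" arbitrary: v rule: less_induct)
  case less
  show ?case
  proof (cases "v \<in> S")
    case False
    then have v: "v \<in> V - S" using less.prems by blast
    then obtain r where "r \<in> S" "forces\<^sup>*\<^sup>* r (f v)"
      using less.hyps[of "f v"] t_f E_f E_V by blast
    moreover have "forces (f v) v" using v by (simp add: forces_def)
    ultimately show ?thesis by (meson rtranclp.rtrancl_into_rtrancl)
  qed blast
qed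

lemma chain_leaves:
  assumes "forces\<^sup>*\<^sup>* x z" "x \<in> A" "z \<notin> A"
  shows "\<exists>y. y \<notin> A \<and> y \<in> V - S \<and> f y \<in> A \<and> forces\<^sup>*\<^sup>* y z"
  using assms
proof (induction rule: converse_rtranclp_induct)
  case (step x y)
  then show ?case unfolding forces_def by (cases "y \<in> A") auto
qed simp

text \<open>If two sibling branches avoided the new set, then the chain from \<open>r\<close> to \<open>z\<close> would run from one of
  them through the common parent into the other one, and could not leave it again.\<close>

lemma branch_condition_exchange:
  assumes r: "r \<in> S" "forces\<^sup>*\<^sup>* r z" and z: "z \<in> V - S" "h z = 0" "h (f z) = 0"
  shows "branch_condition (insert z (S - {r}))"
proof -
  let ?R = "insert z (S - {r})"
  have key: False if ab: "a \<in> V" "b \<in> V" "0 < h a" "0 < h b" "a \<noteq> b" "par a = par b"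
    and e: "sub a \<inter> ?R = {}" "sub b \<inter> ?R = {}" and ra: "r \<in> sub a" for a b
  proof -
    have dis: "sub a \<inter> sub b = {}"
      using sub_disjoint[of a b] h_par[of a] h_par[of b] ab by simp
    have "sub b \<inter> S = {}" using e dis ra by blast
    note b = forced_by_parent[OF ab(2,4) this]
    have "z \<notin> sub a" "z \<notin> sub b" using e by auto
    obtain y where y: "y \<notin> sub a" "y \<in> V - S" "f y \<in> sub a" "forces\<^sup>*\<^sup>* y z"
      using chain_leaves[OF r(2) ra \<open>z \<notin> sub a\<close>] by blast
    have ya: "y = par a" using sub_exit(2)[OF ab(1,3) y(3,1)] E_f y by blast
    \<comment> \<open>\<open>z\<close> is forced by a vertex of height 0, but \<open>y\<close> by a
      vertex of the branch, so the chain goes on after \<open>y\<close>.\<close>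
    have "y \<noteq> z" using y(3) z(3) sub_h[of "f z" a] ab by auto
    then obtain w where w: "forces y w" "forces\<^sup>*\<^sup>* w z"
      using y(4) by (metis converse_rtranclpE)
    have "w = b" using w(1) f_inj b ya ab(6) unfolding forces_def by metis
    then obtain y' where y': "y' \<notin> sub b" "y' \<in> V - S" "f y' \<in> sub b"
      using chain_leaves[OF w(2) _ \<open>z \<notin> sub b\<close>] sub_refl ab by blast
    \<comment> \<open>Leaving the second branch leads back to the common parent, so
      \<open>y' = y\<close> would be forced from both of the disjoint branches.\<close>
    have "y' = par b" using sub_exit(2)[OF ab(2,4) y'(3,1)] E_f y' by blast
    then show False using ya ab(6) y y' dis by auto
  qed
  show ?thesis unfolding branch_condition_def
  proof (intro ballI impI, rule ccontr)
    fix a b assume ab: "a \<in> V" "b \<in> V" "0 < h a \<and> 0 < h b \<and> a \<noteq> b \<and> par a = par b"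
      and "\<not> (sub a \<inter> ?R \<noteq> {} \<or> sub b \<inter> ?R \<noteq> {})"
    then have e: "sub a \<inter> ?R = {}" "sub b \<inter> ?R = {}" by auto
    have "sub a \<inter> S \<noteq> {} \<or> sub b \<inter> S \<noteq> {}"
      using branch_condition_S ab unfolding branch_condition_def by blast
    then have "r \<in> sub a \<or> r \<in> sub b" using e by blast
    then show False using key[of a b] key[of b a] ab e by auto
  qed
qed

text \<open>\<open>c i\<close> could also be forced by \<open>c (i - 1)\<close> or by a child. The
  former fails because \<open>c 0\<close> forces the empty branch and each later
  \<open>c (i - 1)\<close> is itself forced by \<open>c i\<close>; the latter because the tree at
  \<open>c i\<close> avoids \<open>S\<close>, so the child is forced by \<open>c i\<close>.\<close>

lemma one_sided_chain:
  assumes "one_sided S" "1 \<le> i" "i \<le> m"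
  shows "c i \<in> V - S" "f (c i) = c (i + 1)"
proof -
  obtain a where a: "a \<in> V" "h a = 1" "par a = c 0" "sub a \<inter> S = {}"
    using assms(1) unfolding one_sided_def by blast
  have fa: "a \<in> V - S" "f a = c 0" using forced_by_parent[of a] a by auto
  have noS: "rt s \<noteq> c i" if "s \<in> S" "1 \<le> i" "i \<le> m" for s i
  proof -
    obtain k where "0 \<le> k" "k \<le> m - 1" "rt s = c (- k)"
      using assms(1) \<open>s \<in> S\<close> unfolding one_sided_def by blast
    then show ?thesis using c_neq[of i "- k"] that by auto
  qed
  have c_S: "c i \<in> V - S" if "1 \<le> i" "i \<le> m" for i
    using noS[of "c i" i] that c_V rt_c by blast
  have f_c: "f (c i) = c (i + 1)"
    if i: "1 \<le> i" "i \<le> m" and not_pred: "f (c i) \<noteq> c (i - 1)" for i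
  proof -
    have "E (c i) (f (c i))" using E_sym E_f c_S i by blast
    from E_from_c[OF this] E_V2[OF this]
    consider "f (c i) = c (i + 1)" | "0 < h (f (c i))" "par (f (c i)) = c i" "f (c i) \<in> V"
      using not_pred by auto
    then show ?thesis
    proof cases
      case 2
      have "rt s = c i" if "s \<in> sub (f (c i))" for s
        using sub_rt[OF that] rt_par[OF 2(3,1)] 2(2) rt_c by simp
      then have "sub (f (c i)) \<inter> S = {}" using noS i by blast
      then have "f (c i) \<in> V - S" "f (f (c i)) = c i"
        using forced_by_parent[OF 2(3,1)] 2(2) by auto
      then show ?thesis using t_f[of "f (c i)"] t_f[OF c_S[OF i]] by simp
    qed
  qed
  show "f (c i) = c (i + 1)" using assms(2,3)
  proof (induction i rule: int_ge_induct)
    case base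
    have "f (c 1) \<noteq> c 0" using f_inj[OF fa(1) c_S[of 1]] fa(2) a(2) h_c[of 1] base by auto
    then show ?case using f_c[of 1] base by simp
  next
    case (step i)
    then have "f (c i) = c (i + 1)" by simp
    then have "f (c (i + 1)) \<noteq> c i"
      using t_f[OF c_S[of i]] t_f[OF c_S[of "i + 1"]] step by force
    then show ?case using f_c[of "i + 1"] step by simp
  qed
  show "c i \<in> V - S" using c_S assms by blast
qed

lemma one_sided_exchange:
  assumes "one_sided S"
  shows "\<exists>R\<subseteq>V. card R \<le> card S \<and> (\<forall>u\<in>V. \<forall>w\<in>V. u \<noteq> w \<longrightarrow> (\<exists>s\<in>R. d s u \<noteq> d s w))"
proof -
  obtain r where r: "r \<in> S" "forces\<^sup>*\<^sup>* r (c m)" using chain_start c_V by blast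
  have chain: "forces\<^sup>*\<^sup>* r (c i)" if "i \<le> m" "1 \<le> i" for i
    using that
  proof (induction i rule: int_le_induct)
    case (step i)
    then have "forces (c i) (c (i - 1))"
      using one_sided_chain[OF assms, of "i - 1"] by (simp add: forces_def)
    then show ?case using step by (simp add: rtranclp.rtrancl_into_rtrancl)
  qed (rule r)
  obtain s where s: "s \<in> S" "s \<noteq> r" using S_two_trees by metis
  then obtain k where k: "0 \<le> k" "k \<le> m - 1" "rt s = c (- k)"
    using assms unfolding one_sided_def by blast
  \<comment> \<open>\<open>z\<close> is antipodal to the root of \<open>s\<close>. The bounds on
    \<open>k\<close> put its index between 1 and \<open>m\<close>, so \<open>z\<close> lies on the
    chain and is forced by a cycle vertex, as the exchange requires.\<close>
  define z where "z = c (m - k)"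
  have z: "z \<in> V - S" "f z = c (m - k + 1)"
    using one_sided_chain[OF assms, of "m - k"] k unfolding z_def by simp_all
  let ?R = "insert z (S - {r})"
  have "branch_condition ?R"
    using branch_condition_exchange[of r z] r(1) chain[of "m - k"] k z h_c by (simp add: z_def)
  moreover have "?R \<subseteq> V" using z S_V by blast
  moreover have "rt z = c (- k + m)" using rt_c[of "m - k"] by (simp add: z_def)
  ultimately have "\<forall>u\<in>V. \<forall>w\<in>V. u \<noteq> w \<longrightarrow> (\<exists>s\<in>?R. d s u \<noteq> d s w)"
    using antipodal_resolving[of ?R s z "- k"] s k(3) by blast
  moreover have "card ?R \<le> card S"
    using r(1) finite_subset[OF S_V finite_V] card_insert_le_m1[of "card S" "S - {r}" z]
    by (metis card_Diff_singleton card_gt_0_iff empty_iff order_refl)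
  ultimately show ?thesis using \<open>?R \<subseteq> V\<close> by blast
qed

lemma exists_resolving:
  "\<exists>R\<subseteq>V. card R \<le> card S \<and> (\<forall>u\<in>V. \<forall>w\<in>V. u \<noteq> w \<longrightarrow> (\<exists>s\<in>R. d s u \<noteq> d s w))"
proof (cases "\<forall>u\<in>V. \<forall>w\<in>V. u \<noteq> w \<longrightarrow> (\<exists>s\<in>S. d s u \<noteq> d s w)")
  case True
  then show ?thesis using S_V by blast
next
  case False
  then obtain u w where uw: "u \<in> V" "w \<in> V" "u \<noteq> w" "\<forall>s\<in>S. d s u = d s w" by blast
  obtain s1 s2 where s: "s1 \<in> S" "s2 \<in> S" "rt s1 \<noteq> rt s2" using S_two_trees by blast
  obtain c' where c': "odd_unicyclic V E d par h c' m" "odd_unicyclic.one_sided V par h c' m S"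
    using unresolved_one_sided[OF S_V branch_condition_S s uw] by blast
  interpret c': odd_unicyclic V E d par h c' m by fact
  \<comment> \<open>The conditions on the schedule do not mention \<open>c\<close>, so they carry
    over to the new indexing of the cycle.\<close>
  interpret c': forcing_schedule V E d par h c' m S t f
    by unfold_locales (use S_V E_f t_f t_other in auto)
  show ?thesis by (rule c'.one_sided_exchange[OF c'(2)])
qed

end

section \<open>From forcing steps to a schedule\<close>

text \<open>The strict bound \<open>k\<close> on all times so far is carried through the induction:
  it becomes the time of the next forced vertex.\<close>

lemma forcing_schedule_exists:
  assumes "(forcing_step G)\<^sup>*\<^sup>* S B"
  shows "S \<subseteq> B \<and> (\<exists>t f k. (\<forall>x\<in>B. t x < (k :: nat)) \<and>
    (\<forall>v\<in>B - S. f v \<in> B \<and> (f v, v) \<in> parcs G \<and> t (f v) < t v \<and>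
      (\<forall>y. (f v, y) \<in> parcs G \<and> y \<noteq> v \<longrightarrow> y \<in> B \<and> t y < t v)))"
  using assms
proof (induction rule: rtranclp_induct)
  case base
  show ?case by (auto intro!: exI[of _ "\<lambda>_. 0 :: nat"] exI[of _ 1])
next
  case (step B B')
  obtain t f and k :: nat where tf: "\<forall>x\<in>B. t x < k"
    "\<forall>v\<in>B - S. f v \<in> B \<and> (f v, v) \<in> parcs G \<and> t (f v) < t v \<and>
      (\<forall>y. (f v, y) \<in> parcs G \<and> y \<noteq> v \<longrightarrow> y \<in> B \<and> t y < t v)"
    using step.IH by blast
  obtain u v where uv: "u \<in> B" "neighbors G u - B = {v}" "B' = insert v B"
    using step.hyps(2) unfolding forcing_step_def by blast
  then have v: "v \<notin> B" "(u, v) \<in> parcs G" and nb: "\<And>y. (u, y) \<in> parcs G \<Longrightarrow> y \<noteq> v \<Longrightarrow> y \<in> B"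
    unfolding neighbors_def by blast+
  have "\<forall>x\<in>B'. (t(v := k)) x < Suc k" using tf(1) uv(3) by (auto intro: less_SucI)
  moreover have "(f(v := u)) w \<in> B' \<and> ((f(v := u)) w, w) \<in> parcs G \<and>
      (t(v := k)) ((f(v := u)) w) < (t(v := k)) w \<and>
      (\<forall>y. ((f(v := u)) w, y) \<in> parcs G \<and> y \<noteq> w \<longrightarrow> y \<in> B' \<and> (t(v := k)) y < (t(v := k)) w)"
    if w: "w \<in> B' - S" for w
  proof (cases "w = v")
    case True
    then show ?thesis using uv v nb tf(1) by auto
  next
    case False
    then have wB: "w \<in> B - S" using w uv by blast
    note W = bspec[OF tf(2) wB]
    \<comment> \<open>All vertices in the conditions recorded for \<open>w\<close> lie in
      \<open>B\<close>, so redefining \<open>t\<close> and \<open>f\<close> at \<open>v\<close>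
      leaves them intact.\<close>
    have "f w \<noteq> v" using W v by auto
    then show ?thesis using False W v uv(3) by auto
  qed
  ultimately show ?case using step.IH uv(3)
    by (intro conjI exI[of _ "t(v := k)"] exI[of _ "f(v := u)"] exI[of _ "Suc k"] ballI) blast+
qed

section \<open>The structure of a unicyclic graph\<close>

context pair_graph
begin

lemma awalk_nth:
  assumes "awalk u p v" "k < length p"
  shows "fst (p ! k) = (if k = 0 then u else snd (p ! (k - 1)))"
  using assms
proof (induction p arbitrary: u k)
  case (Cons e p)
  then have e: "fst e = u" "awalk (snd e) p v" by (auto simp: awalk_Cons_iff)
  show ?case
  proof (cases k)
    case (Suc j)
    then show ?thesis using Cons.IH[OF e(2), of j] Cons.prems(2) by (cases j) auto
  qed (use e in simp)
qed simp

lemma awalk_last: "awalk u p v \<Longrightarrow> p \<noteq> [] \<Longrightarrow> snd (last p) = v"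
  by (induction p arbitrary: u) (auto simp: awalk_Cons_iff awalk_Nil_iff)

text \<open>\<open>c i\<close> is the head of the arc of \<open>p\<close> with index
  \<open>i mod n\<close>, and the heads of a cycle are distinct.\<close>

lemma cycle_parametrisation:
  assumes p: "cycle p" and n: "n = int (length p)"
  obtains c :: "int \<Rightarrow> 'a" where "\<And>i j. c i = c j \<longleftrightarrow> n dvd i - j"
    "set p = range (\<lambda>i. (c i, c (i + 1)))"
proof -
  obtain u where u: "awalk u p u" "distinct (tl (pawalk_verts u p))" "p \<noteq> []"
    using p unfolding cycle_def by auto
  have "pawalk_verts u p = fst (hd p) # map snd p"
    using awalk_verts_conv'[of u p u] u by (auto simp: awalk_def)
  then have dist: "distinct (map snd p)" using u(2) by simp
  have n0: "0 < n" using u(3) n by simp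
  define ix where "ix i = nat (i mod n)" for i
  have ix: "ix i < length p" for i using n0 n by (simp add: ix_def nat_less_iff)
  define c where "c i = snd (p ! ix i)" for i
  have "c i = c j \<longleftrightarrow> n dvd i - j" for i j
  proof -
    have "c i = c j \<longleftrightarrow> ix i = ix j"
      using ix dist by (auto simp: c_def distinct_conv_nth)
    also have "\<dots> \<longleftrightarrow> i mod n = j mod n" using n0 by (simp add: ix_def eq_nat_nat_iff)
    finally show ?thesis by (simp add: mod_eq_dvd_iff)
  qed
  moreover have arc: "p ! ix (i + 1) = (c i, c (i + 1))" for i
  proof -
    have "fst (p ! ix (i + 1)) = c i"
    proof (cases "i mod n = n - 1")
      case True
      \<comment> \<open>Wrapping around: the tail of the first arc is the head of the last one
        because the walk is closed.\<close>
      then have "(i + 1) mod n = 0" by (metis add.commute diff_add_cancel mod_add_left_eq mod_self)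
      then have "ix (i + 1) = 0" by (simp add: ix_def)
      moreover have "ix i = length p - 1" using True n n0 by (simp add: ix_def)
      ultimately show ?thesis
        using awalk_nth[OF u(1), of 0] awalk_last[OF u(1,3)] u(3) by (simp add: c_def last_conv_nth)
    next
      case False
      have b: "0 \<le> i mod n" "i mod n < n" using n0 by auto
      have "(i + 1) mod n = (i mod n + 1) mod n" by (simp add: mod_add_left_eq)
      also have "\<dots> = i mod n + 1" using b False by (intro mod_pos_pos_trivial) auto
      finally have "ix (i + 1) = Suc (ix i)" using b by (simp add: ix_def nat_add_distrib)
      then show ?thesis
        using awalk_nth[OF u(1) ix[of "i + 1"]] by (simp add: c_def)
    qed
    then show ?thesis by (simp add: c_def prod_eq_iff)
  qed
  moreover have "set p = range (\<lambda>i. (c i, c (i + 1)))"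
  proof
    show "range (\<lambda>i. (c i, c (i + 1))) \<subseteq> set p"
      using nth_mem[OF ix] by (auto simp flip: arc)
    show "set p \<subseteq> range (\<lambda>i. (c i, c (i + 1)))"
    proof
      fix e assume "e \<in> set p"
      then obtain k where k: "k < length p" "e = p ! k" by (auto simp: in_set_conv_nth)
      have "ix (int k) = k" using k n by (simp add: ix_def)
      then have "e = (c (int k - 1), c (int k - 1 + 1))" using arc[of "int k - 1"] k by simp
      then show "e \<in> range (\<lambda>i. (c i, c (i + 1)))" by blast
    qed
  qed
  ultimately show thesis using that[of c] by simp
qed

text \<open>Two arcs give the same edge only if they are equal or opposite, and opposite arcs would
  make the length divide 2. This turns the parity of \<open>card C\<close> into that of the cycle
  length.\<close>

lemma card_cycle_edges:
  assumes p: "cycle p" "3 \<le> length p"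
  shows "card ((\<lambda>(u, v). {u, v}) ` set p) = length p"
proof -
  obtain c where c: "\<And>i j. c i = c j \<longleftrightarrow> int (length p) dvd i - j"
    "set p = range (\<lambda>i. (c i, c (i + 1)))"
    using cycle_parametrisation[OF p(1) refl] by blast
  have "inj_on (\<lambda>(u, v). {u, v}) (set p)"
  proof (rule inj_onI)
    fix x y assume xy: "x \<in> set p" "y \<in> set p" "(case x of (u, v) \<Rightarrow> {u, v}) = (case y of (u, v) \<Rightarrow> {u, v})"
    then obtain i j where ij: "x = (c i, c (i + 1))" "y = (c j, c (j + 1))" using c(2) by auto
    then have "{c i, c (i + 1)} = {c j, c (j + 1)}" using xy by simp
    then consider "c i = c j" "c (i + 1) = c (j + 1)" | "c i = c (j + 1)" "c (i + 1) = c j"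
      by (auto simp: doubleton_eq_iff)
    then show "x = y"
    proof cases
      case 2
      then have "int (length p) dvd i - (j + 1)" "int (length p) dvd (i + 1) - j" using c(1) by auto
      then have "int (length p) dvd ((i + 1) - j) - (i - (j + 1))" by (rule dvd_diff[rotated])
      then have "int (length p) dvd 2" by simp
      then show ?thesis using zdvd_imp_le[of "int (length p)" 2] p(2) by simp
    qed (use ij in simp)
  qed
  moreover have "distinct p" using p(1) cycle_conv by blast
  ultimately show ?thesis by (simp add: card_image distinct_card)
qed

text \<open>Shortening a walk to a path only drops arcs, so the restriction to \<open>Q\<close>
  survives.\<close>

lemma restricted_apath:
  assumes "Q\<^sup>*\<^sup>* x y" "x \<in> pverts G" "\<And>a b. Q a b \<Longrightarrow> (a, b) \<in> parcs G"
  obtains p where "apath x p y" "\<forall>(a, b)\<in>set p. Q a b"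
proof -
  have "\<exists>p. awalk x p y \<and> (\<forall>(a, b)\<in>set p. Q a b)"
    using assms(1)
  proof (induction rule: rtranclp_induct)
    case base
    then show ?case using assms(2) by (intro exI[of _ "[]"]) (simp add: awalk_Nil_iff)
  next
    case (step y z)
    then obtain p where p: "awalk x p y" "\<forall>(a, b)\<in>set p. Q a b" by blast
    have "(y, z) \<in> parcs G" using step assms(3) by blast
    then have "awalk y [(y, z)] z" using in_arcsD1 in_arcsD2 by (simp add: awalk_simps)
    then have "awalk x (p @ [(y, z)]) z" using p by (blast intro: awalk_appendI)
    then show ?case using p step by (intro exI[of _ "p @ [(y, z)]"]) auto
  qed
  then obtain p where p: "awalk x p y" "\<forall>(a, b)\<in>set p. Q a b" by blast
  then show thesis
    using that[OF apath_awalk_to_apath[OF p(1)]] awalk_to_apath_subset[OF p(1)] by blast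
qed

text \<open>A path with a single arc would be \<open>(x, y)\<close> itself, so the path has at least
  two arcs and the closed walk is not a degenerate one of length 2.\<close>

lemma chord_closes_cycle:
  assumes "apath x q y" "(y, x) \<in> parcs G" "(x, y) \<notin> set q"
  shows "cycle (q @ [(y, x)])" "3 \<le> length (q @ [(y, x)])"
proof -
  have q: "awalk x q y" "distinct (pawalk_verts x q)"
    using assms(1) by (auto simp: apath_def)
  have "x \<noteq> y" using assms(2) no_loops' by blast
  then have ne: "q \<noteq> []" using q by (auto simp: awalk_Nil_iff)
  then obtain e q' where e: "q = e # q'" by (cases q) auto
  have "q' \<noteq> []"
  proof
    assume "q' = []"
    then have "e = (x, y)" using q(1) e by (auto simp: awalk_simps prod_eq_iff)
    then show False using e assms(3) by simp
  qed
  then show "3 \<le> length (q @ [(y, x)])" using e by (cases q') auto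
  have yx: "awalk y [(y, x)] x" using assms(2) in_arcsD1 in_arcsD2 by (simp add: awalk_simps)
  have "awalk x (q @ [(y, x)]) x" using q(1) yx by (rule awalk_appendI)
  moreover have "distinct (tl (pawalk_verts x (q @ [(y, x)])))"
  proof -
    have "pawalk_verts x q = fst (hd q) # map snd q"
      using awalk_verts_conv'[of x q y] q ne by (auto simp: awalk_def)
    moreover have "fst (hd q) = x" using q(1) e by (auto simp: awalk_Cons_iff)
    moreover have "pawalk_verts x (q @ [(y, x)]) = fst (hd (q @ [(y, x)])) # map snd (q @ [(y, x)])"
      using awalk_verts_conv'[of x "q @ [(y, x)]" x] \<open>awalk x (q @ [(y, x)]) x\<close> by (auto simp: awalk_def)
    ultimately show ?thesis using q(2) by simp
  qed
  ultimately show "cycle (q @ [(y, x)])" unfolding cycle_def by blast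
qed

end

lemma length_rev_path [simp]: "length (rev_path p) = length p"
  by (induct p) auto

section \<open>Distance in a connected graph\<close>

locale connected_pair_graph = pair_graph +
  assumes reachable: "u \<in> pverts G \<Longrightarrow> v \<in> pverts G \<Longrightarrow> \<exists>p. awalk u p v"
begin

text \<open>The natural-number form of \<open>graph_dist\<close>, which permits induction on
  distances.\<close>

definition hops :: "'a \<Rightarrow> 'a \<Rightarrow> nat" where
  "hops u v = (LEAST k. \<exists>p. awalk u p v \<and> length p = k)"

lemma hops_le: "awalk u p v \<Longrightarrow> hops u v \<le> length p"
  unfolding hops_def by (rule Least_le) blast

lemma hops_attained:
  assumes "u \<in> pverts G" "v \<in> pverts G"
  obtains p where "awalk u p v" "length p = hops u v"
proof -
  have "\<exists>k p. awalk u p v \<and> length p = k" using reachable assms by blast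
  then have "\<exists>p. awalk u p v \<and> length p = hops u v"
    unfolding hops_def by (rule LeastI_ex)
  then show thesis using that by blast
qed

lemma graph_dist_eq_hops:
  assumes "u \<in> pverts G" "v \<in> pverts G"
  shows "graph_dist G u v = ereal (real (hops u v))"
proof -
  have cost: "awalk_cost (\<lambda>_. 1) p = real (length p)" for p :: "('a \<times> 'a) list"
    by (simp add: awalk_cost_def sum_list_triv)
  obtain p where p: "awalk u p v" "length p = hops u v" using hops_attained assms by blast
  have "\<mu> (\<lambda>_. 1) u v = ereal (real (hops u v))"
  proof (rule antisym)
    show "\<mu> (\<lambda>_. 1) u v \<le> ereal (real (hops u v))"
      using min_cost_le_walk_cost[OF p(1), of "\<lambda>_. 1"] cost p(2) by simp
    show "ereal (real (hops u v)) \<le> \<mu> (\<lambda>_. 1) u v"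
      unfolding \<mu>_def by (rule INF_greatest) (auto simp: cost hops_le)
  qed
  then show ?thesis by (simp add: graph_dist_def)
qed

sublocale graph_metric "pverts G" "\<lambda>x y. (x, y) \<in> parcs G" hops
proof
  show "finite (pverts G)" by (rule pair_finite_verts)
  show "(y, x) \<in> parcs G" if "(x, y) \<in> parcs G" for x y using arcs_symmetric that .
  show "x \<in> pverts G" if "(x, y) \<in> parcs G" for x y using in_arcsD1 that .
  show "(x, x) \<notin> parcs G" for x using no_loops' by blast
  show "hops x x = 0" if "x \<in> pverts G" for x
    using hops_le[of x "[]" x] that by (simp add: awalk_Nil_iff)
  show "hops x y = hops y x" for x y
  proof -
    have "(\<exists>p. awalk x p y \<and> length p = k) \<longleftrightarrow> (\<exists>p. awalk y p x \<and> length p = k)" for k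
    proof
      assume "\<exists>p. awalk x p y \<and> length p = k"
      then obtain p where "awalk x p y" "length p = k" by blast
      then show "\<exists>p. awalk y p x \<and> length p = k" by (intro exI[of _ "rev_path p"]) simp
    next
      assume "\<exists>p. awalk y p x \<and> length p = k"
      then obtain p where "awalk y p x" "length p = k" by blast
      then show "\<exists>p. awalk x p y \<and> length p = k" by (intro exI[of _ "rev_path p"]) simp
    qed
    then show ?thesis unfolding hops_def by simp
  qed
  show "hops x z \<le> hops x y + hops y z" if V: "x \<in> pverts G" "y \<in> pverts G" "z \<in> pverts G" for x y z
  proof -
    obtain p where p: "awalk x p y" "length p = hops x y" using hops_attained V by blast
    obtain q where q: "awalk y q z" "length q = hops y z" using hops_attained V by blast
    show ?thesis using hops_le[OF awalk_appendI[OF p(1) q(1)]] p q by simp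
  qed
  show "hops x y \<le> 1" if "(x, y) \<in> parcs G" for x y
    using hops_le[of x "[(x, y)]" y] that in_arcsD1 in_arcsD2 by (simp add: awalk_simps)
  show "\<exists>z. (x, z) \<in> parcs G \<and> hops x y = Suc (hops z y)"
    if V: "x \<in> pverts G" "y \<in> pverts G" "x \<noteq> y" for x y
  proof -
    obtain p where p: "awalk x p y" "length p = hops x y" using hops_attained V by blast
    have "p \<noteq> []" using p V by (auto simp: awalk_Nil_iff)
    then obtain e q where e: "p = e # q" by (cases p) auto
    then have z: "(x, snd e) \<in> parcs G" "awalk (snd e) q y"
      using p(1) by (auto simp: awalk_Cons_iff)
    obtain q' where q': "awalk (snd e) q' y" "length q' = hops (snd e) y"
      using hops_attained[of "snd e" y] z(1) in_arcsD2 V by blast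
    have "awalk x ((x, snd e) # q') y"
      using q'(1) z(1) in_arcsD1 by (simp add: awalk_Cons_iff)
    from hops_le[OF this] have "hops x y \<le> Suc (hops (snd e) y)" using q'(2) by simp
    then have "hops x y = Suc (hops (snd e) y)" using hops_le[OF z(2)] p(2) e by simp
    then show ?thesis using z(1) by blast
  qed
qed

end

section \<open>Recognising the cycle with its trees\<close>

context connected_pair_graph
begin

text \<open>Height is the distance to the cycle, and a parent is a neighbour one step closer. The
  uniqueness of the cycle then shows that cycle edges and parent edges are all edges.\<close>

lemma unicyclic_structure:
  assumes C: "undirected_cycles G = {C}" "odd (card C)"
  shows "\<exists>par h c m. odd_unicyclic (pverts G) (\<lambda>x y. (x, y) \<in> parcs G) hops par h c m"
proof -
  have "C \<in> undirected_cycles G" using C(1) by simp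
  then obtain p where p: "cycle p" "3 \<le> length p" "C = (\<lambda>(u, v). {u, v}) ` set p"
    unfolding undirected_cycles_def by (elim CollectE exE conjE) (rule that)
  define m where "m = int (length p div 2)"
  have "odd (length p)" using card_cycle_edges[OF p(1,2)] p(3) C(2) by simp
  then have "2 * (length p div 2) + 1 = length p" by simp
  then have len: "int (length p) = 2 * m + 1" unfolding m_def by linarith
  have m1: "1 \<le> m" using p(2) len by linarith
  obtain c where c: "\<And>i j. c i = c j \<longleftrightarrow> (2 * m + 1) dvd i - j"
    "set p = range (\<lambda>i. (c i, c (i + 1)))"
    using cycle_parametrisation[OF p(1) len[symmetric]] by blast
  have "set p \<subseteq> parcs G" using p(1) by (auto simp: cycle_def awalk_def)
  then have Ec: "(c i, c (i + 1)) \<in> parcs G" for i using c(2) by blast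
  have cV: "c i \<in> pverts G" for i using Ec in_arcsD1 by blast

  define h where "h x = (LEAST k. \<exists>i. hops x (c i) = k)" for x
  have h_att: "\<exists>i. hops x (c i) = h x" for x
    unfolding h_def by (rule LeastI_ex) blast
  have h_le: "h x \<le> hops x (c i)" for x i
    unfolding h_def by (rule Least_le) blast
  have h_c: "h (c i) = 0" for i using h_le[of "c i" i] d_self[OF cV] by simp
  define par where "par x = (SOME y. (x, y) \<in> parcs G \<and> h x = Suc (h y))" for x
  have par: "(x, par x) \<in> parcs G \<and> h x = Suc (h (par x))" if x: "x \<in> pverts G" "0 < h x" for x
    unfolding par_def
  proof (rule someI_ex)
    obtain i where i: "hops x (c i) = h x" using h_att by blast
    have "x \<noteq> c i" using x h_c by auto
    then obtain z where z: "(x, z) \<in> parcs G" "hops x (c i) = Suc (hops z (c i))"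
      using d_next[OF x(1) cV] by blast
    obtain j where j: "hops z (c j) = h z" using h_att by blast
    have zV: "z \<in> pverts G" using z in_arcsD2 by blast
    have "h x \<le> hops x z + hops z (c j)"
      using h_le[of x j] d_tri[OF x(1) zV cV, of j] by simp
    then have "h x \<le> Suc (h z)" using j d_adj[OF z(1)] by simp
    then show "\<exists>y. (x, y) \<in> parcs G \<and> h x = Suc (h y)" using z h_le[of z i] i by (intro exI[of _ z]) auto
  qed
  have base: "x \<in> pverts G \<and> h x = 0 \<longleftrightarrow> x \<in> range c" for x
  proof
    assume x: "x \<in> pverts G \<and> h x = 0"
    obtain i where "hops x (c i) = h x" using h_att by blast
    then have "x = c i" using d_next[of x "c i"] x cV by fastforce
    then show "x \<in> range c" by blast
  qed (use cV h_c in auto)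

  \<comment> \<open>The cycle edges together with the parent edges; they already connect all
    vertices.\<close>
  define Q where "Q x y \<longleftrightarrow> (\<exists>i. x = c i \<and> y = c (i + 1) \<or> x = c (i + 1) \<and> y = c i) \<or>
    x \<in> pverts G \<and> 0 < h x \<and> y = par x \<or> y \<in> pverts G \<and> 0 < h y \<and> x = par y" for x y
  have Q_sym: "Q x y \<Longrightarrow> Q y x" for x y unfolding Q_def by blast
  have Q_arc: "(x, y) \<in> parcs G" if "Q x y" for x y
    using that Ec par arcs_symmetric unfolding Q_def by metis
  have Q_cycle_nat: "Q\<^sup>*\<^sup>* (c i) (c (i + int k))" for i k
  proof (induction k)
    case (Suc k)
    have "Q (c (i + int k)) (c (i + int k + 1))" unfolding Q_def by blast
    then have "Q (c (i + int k)) (c (i + int (Suc k)))" by (simp add: algebra_simps)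
    then show ?case using Suc by (rule rtranclp.rtrancl_into_rtrancl[rotated])
  qed simp
  have Q_cycle: "Q\<^sup>*\<^sup>* (c i) (c j)" for i j
  proof -
    define k where "k = (j - i) mod (2 * m + 1)"
    have "0 \<le> k" using m1 by (simp add: k_def)
    have "(2 * m + 1) dvd j - (i + k)"
      using dvd_minus_mod[of "2 * m + 1" "j - i"] by (simp add: k_def algebra_simps)
    then have "c j = c (i + k)" using c(1) by blast
    then show ?thesis using Q_cycle_nat[of i "nat k"] \<open>0 \<le> k\<close> by simp
  qed
  have Q_up: "\<exists>i. Q\<^sup>*\<^sup>* x (c i)" if "x \<in> pverts G" for x
    using that
  proof (induction "h x" arbitrary: x)
    case 0
    then show ?case using base[of x] by auto
  next
    case (Suc k)
    then have x: "x \<in> pverts G" "0 < h x" by auto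
    then obtain i where "Q\<^sup>*\<^sup>* (par x) (c i)"
      using Suc.hyps(1)[of "par x"] Suc.hyps(2) par[OF x] in_arcsD2 by auto
    moreover have "Q x (par x)" using x unfolding Q_def by blast
    ultimately show ?case by (meson converse_rtranclp_into_rtranclp)
  qed
  have Q_conn: "Q\<^sup>*\<^sup>* x y" if "x \<in> pverts G" "y \<in> pverts G" for x y
  proof -
    obtain i j where "Q\<^sup>*\<^sup>* x (c i)" "Q\<^sup>*\<^sup>* y (c j)" using Q_up \<open>x \<in> pverts G\<close> \<open>y \<in> pverts G\<close> by blast
    moreover have "Q\<^sup>*\<^sup>* (c j) y"
      using \<open>Q\<^sup>*\<^sup>* y (c j)\<close> Q_sym by (metis sympI sympD symp_rtranclp)
    ultimately show ?thesis using Q_cycle by (meson rtranclp_trans)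
  qed
  \<comment> \<open>An arc outside \<open>Q\<close> would close a cycle with a \<open>Q\<close>-path
    between its ends. By uniqueness the edges of this cycle are those of \<open>C\<close>, which all
    belong to \<open>Q\<close>.\<close>
  have arc_Q: "Q x y" if xy: "(x, y) \<in> parcs G" for x y
  proof (rule ccontr)
    assume notQ: "\<not> Q x y"
    have V: "x \<in> pverts G" "y \<in> pverts G" using xy in_arcsD1 in_arcsD2 by blast+
    obtain q where q: "apath x q y" "\<forall>(a, b)\<in>set q. Q a b"
      using restricted_apath[OF Q_conn[OF V] V(1) Q_arc] by blast
    have "(x, y) \<notin> set q" using q(2) notQ by blast
    note cyc = chord_closes_cycle[OF q(1) arcs_symmetric[OF xy] this]
    then have "(\<lambda>(u, v). {u, v}) ` set (q @ [(y, x)]) \<in> undirected_cycles G"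
      unfolding undirected_cycles_def by blast
    then have "{x, y} \<in> C" using C(1) by (auto simp: insert_commute)
    then obtain i where "{x, y} = {c i, c (i + 1)}" using p(3) c(2) by auto
    then have "Q x y" unfolding Q_def by (metis doubleton_eq_iff)
    then show False using notQ by blast
  qed
  have "odd_unicyclic (pverts G) (\<lambda>x y. (x, y) \<in> parcs G) hops par h c m"
  proof (unfold_locales, goal_cases)
    case (1 x)
    then show ?case using par by blast
  next
    case (2 x)
    then show ?case using par by blast
  next
    case (3 x y)
    then show ?case using arc_Q[of x y] h_c unfolding Q_def by metis
  next
    case 4
    show ?case by (rule m1)
  next
    case (5 i j)
    show ?case by (rule c(1))
  next
    case (6 x)
    show ?case by (rule base)
  next
    case (7 i)
    show ?case by (rule Ec)
  next
    case (8 x y)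
    then show ?case using arc_Q[of x y] unfolding Q_def by auto
  qed
  then show ?thesis by blast
qed

end

section \<open>Comparison of the two graph parameters\<close>

theorem theorem4:
  fixes G :: "'a pair_pre_digraph"
  assumes "pair_graph G"
    and "Digraph_Component.connected (with_proj G)"
    and "undirected_cycles G = {C}"
    and "odd (card C)"
  shows "metric_dimension G \<le> zero_forcing_number G"
proof -
  interpret pair_graph G by fact
  have sc: "strongly_connected (with_proj G)"
    using symmetric_connected_imp_strongly_connected pair_sym_arcs assms(2) by blast
  interpret connected_pair_graph G
  proof
    show "\<exists>p. awalk u p v" if "u \<in> pverts G" "v \<in> pverts G" for u v
      using sc that reachable_awalk by (auto simp: strongly_connected_def)
  qed
  obtain par h c m where
    "odd_unicyclic (pverts G) (\<lambda>x y. (x, y) \<in> parcs G) hops par h c m"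
    using unicyclic_structure[OF assms(3,4)] by blast
  then interpret odd_unicyclic "pverts G" "\<lambda>x y. (x, y) \<in> parcs G" hops par h c m .
  \<comment> \<open>The full vertex set is trivially zero forcing, so the minimum in the definition
    is attained.\<close>
  have "zero_forcing_set G (pverts G)" by (simp add: zero_forcing_set_def)
  then have "\<exists>k S. zero_forcing_set G S \<and> card S = k" by blast
  then have "\<exists>S. zero_forcing_set G S \<and> card S = zero_forcing_number G"
    unfolding zero_forcing_number_def by (rule LeastI_ex)
  then obtain S where S: "S \<subseteq> pverts G" "(forcing_step G)\<^sup>*\<^sup>* S (pverts G)"
    "card S = zero_forcing_number G"
    unfolding zero_forcing_set_def by blast
  obtain t f where tf: "\<forall>v\<in>pverts G - S. (f v, v) \<in> parcs G \<and> t (f v) < (t v :: nat) \<and>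
      (\<forall>y. (f v, y) \<in> parcs G \<and> y \<noteq> v \<longrightarrow> t y < t v)"
    using forcing_schedule_exists[OF S(2)] by meson
  interpret forcing_schedule "pverts G" "\<lambda>x y. (x, y) \<in> parcs G" hops par h c m S t f
    by unfold_locales (use S tf in auto)
  obtain R where R: "R \<subseteq> pverts G" "card R \<le> card S"
    "\<forall>u\<in>pverts G. \<forall>w\<in>pverts G. u \<noteq> w \<longrightarrow> (\<exists>s\<in>R. hops s u \<noteq> hops s w)"
    using exists_resolving by blast
  have "graph_dist G s u \<noteq> graph_dist G s w"
    if "s \<in> R" "u \<in> pverts G" "w \<in> pverts G" "hops s u \<noteq> hops s w" for s u w
    using that R(1) graph_dist_eq_hops[of s u] graph_dist_eq_hops[of s w] by auto
  then have "resolving_set G R" using R(1,3) unfolding resolving_set_def by meson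
  then have "metric_dimension G \<le> card R"
    unfolding metric_dimension_def by (intro Least_le) blast
  then show ?thesis using R(2) S(3) by simp
qed

end
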